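(* Let $L_2$ be the lamplighter group with the word metric $d$ for the generating set $\{t,at\}$. Every point of the horofunction boundary $\partial_h L_2$ belongs to one of the following families of horofunctions (points of $\partial_h L_2$): (i) Busemann: the functions $\mathfrak b^{+,\gamma}$ with $[\gamma]\in\partial_\infty L_2^+$ and $\mathfrak b^{-,\gamma}$ with $[\gamma]\in\partial_\infty L_2^-$; each arises as $h_{g_n}$ for a sequence $(g_n)$ in $L_2$ for which the union over $n$ of the sets of positions of lit lamps of $g_n$ is bounded below and $H(g_n)\to+\infty$ (for $\mathfrak b^{+,\gamma}$), respectively bounded above and $H(g_n)\to-\infty$ (for $\mathfrak b^{-,\gamma}$). (ii) Spine: the functions $\mathfrak s^l$, $l\in\mathbb Z$; each arises as $h_{g_n}$ for a sequence for which the union of the sets of lit lamps is neither bounded below nor bounded above and $H(g_n)$ converges to a finite value. (iii) Ribs: the functions $\mathfrak r^{+,f}$, with $f\in L_2$ and $M(f)<H(f)$, and $\mathfrak r^{-,f}$, with $f\in L_2$ and $m(f)\ge H(f)$; each arises as $h_{g_n}$ for a sequence for which the union of the sets of lit lamps is bounded below or above but not both and $H(g_n)$ converges to a finite value. (iv) Height: the functions $H$ and $-H$; each arises as $h_{g_n}$ for a sequence for which the union of the sets of lit lamps is neither bounded below nor bounded above and $H(g_n)\to+\infty$ or $H(g_n)\to-\infty$. Moreover, the set of non-Busemann points of $\partial_h L_2$ is countable.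
   Context: Lamplighter group: $L_2=\langle a,t\mid a^2,\ [a^{t^i},a^{t^j}]\ \forall i,j\in\mathbb Z\rangle\cong(\bigoplus_{\mathbb Z}\mathbb Z/2)\rtimes\mathbb Z$. Each element is identified with a lamp stand: a finite set of lit lamps (positions in $\mathbb Z$) together with an integer position of the lamplighter. The identity $id$ has no lit lamps and lamplighter at $0$; right multiplication by $a$ toggles the lamp at the lamplighter's position; right multiplication by $t$ moves the lamplighter by $+1$. $d$ is the word metric on $L_2$ with respect to $S=\{t,at\}$, i.e. $d(g,h)$ is the length of $g^{-1}h$ in $S\cup S^{-1}$. $H(g)$ is the lamplighter's position in $g$; $m(g)$ (resp. $M(g)$) is the minimum (resp. maximum) position of a lit lamp of $g$, with $m(g)=+\infty$, $M(g)=-\infty$ if no lamp is lit. $m(g_1,g_2)$ (resp. $M(g_1,g_2)$) is the minimum (resp. maximum) position of a lamp whose status differs in $g_1$ and $g_2$, with value $+\infty$ (resp. $-\infty$) if there is none. Horofunction boundary: $C(L_2)$ is the space of functions $L_2\to\mathbb R$ with the topology of uniform convergence on compact (i.e. finite) sets; $i(z)(x)=d(z,x)-d(z,id)$ embeds $L_2$ in $C(L_2)$; $\overline{L_2}$ is the closure of $i(L_2)$ and $\partial_h L_2=\overline{L_2}\setminus i(L_2)$. For a sequence $(g_n)$ in $L_2$, $h_{g_n}(x)=\lim_{n\to\infty}\big(d(g_n,x)-d(g_n,id)\big)$ if this limit exists for all $x$. A point of $\partial_h L_2$ is a Busemann point if it equals $h_{\gamma(n)}$ for some geodesic ray $\gamma$,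 i.e. isometric embedding $\gamma:\mathbb N\to L_2$. Rays: two rays are asymptotic if $\sup_n d(\gamma(n),\gamma'(n))<\infty$; $\partial_\infty L_2^{\pm}$ is the set of asymptotic classes of geodesic rays $\gamma$ with $\gamma(0)=id$ and $H(\gamma(n))\to\pm\infty$. For such a ray each lamp's status in $\gamma(n)$ is eventually constant; the resulting (possibly infinite) configuration is the infinite lamp stand of $\gamma$, which depends only on $[\gamma]$. $m(\gamma),m(\gamma,g)$ (for $\partial_\infty L_2^+$) and $M(\gamma),M(\gamma,g)$ (for $\partial_\infty L_2^-$) are defined from it as for group elements. Formulas, for $g\in L_2$: $\mathfrak b^{+,\gamma}(g)=2(\min\{m(\gamma),0\}-\min\{m(\gamma,g),H(g)\})+H(g)$ for $[\gamma]\in\partial_\infty L_2^+$; $\mathfrak b^{-,\gamma}(g)=2(\max\{M(\gamma,g)+1,H(g)\}-\max\{M(\gamma)+1,0\})-H(g)$ for $[\gamma]\in\partial_\infty L_2^-$; $\mathfrak s^l(g)=|l|-|l-H(g)|$ for $l\in\mathbb Z$; $\mathfrak r^{+,f}(g)=2(\min\{m(f),l,0\}-\min\{m(f,g),H(g),l\})+\mathfrak s^l(g)$ where $l=H(f)$ and $M(f)<l$; $\mathfrak r^{-,f}(g)=2(\max\{M(f,g)+1,H(g),l\}-\max\{M(f)+1,l,0\})+\mathfrak s^l(g)$ where $l=H(f)$ and $m(f)\ge l$. *)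

theory Defs
  imports "HOL-Analysis.Analysis" "HOL-Algebra.Generated_Groups"
begin

section \<open>The lamplighter group\<close>

text \<open>An element is a lamp stand: the finite set of positions of the lit lamps together with the
  position of the lamplighter.\<close>

typedef lamplighter = "{(A :: int set, k :: int). finite A}"
  morphisms rep_lamplighter abs_lamplighter
  by blast

setup_lifting type_definition_lamplighter

lift_definition lamp_stand :: "int set \<Rightarrow> int \<Rightarrow> lamplighter"
  is "\<lambda>A k. (if finite A then A else {}, k)"
  by simp

lift_definition lamps :: "lamplighter \<Rightarrow> int set" is fst .

lift_definition height :: "lamplighter \<Rightarrow> int" is snd .

lemma finite_lamps [simp]: "finite (lamps g)"
  by transfer auto

lemma lamps_lamp_stand [simp]: "finite A \<Longrightarrow> lamps (lamp_stand A k) = A"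
  by transfer simp

lemma height_lamp_stand [simp]: "height (lamp_stand A k) = k"
  by transfer simp

lemma lamp_stand_collapse [simp]: "lamp_stand (lamps g) (height g) = g"
  by transfer auto

lemma lamplighter_eq_iff: "g = h \<longleftrightarrow> lamps g = lamps h \<and> height g = height h"
  by (metis lamp_stand_collapse)

text \<open>The semidirect product of the finitely supported lamp configurations with the integers:
  the lamps of the right factor are read relative to the lamplighter of the left factor.\<close>

definition L2 :: "lamplighter monoid" where
  "L2 = \<lparr>carrier = UNIV,
         mult = (\<lambda>g h. lamp_stand (sym_diff (lamps g) ((\<lambda>i. height g + i) ` lamps h)) (height g + height h)),
         one = lamp_stand {} 0\<rparr>"

definition lamp_a :: lamplighter where "lamp_a = lamp_stand {0} 0"

definition lamp_t :: lamplighter where "lamp_t = lamp_stand {} 1"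

lemma carrier_L2 [simp]: "carrier L2 = UNIV"
  by (simp add: L2_def)

lemma lamps_one [simp]: "lamps \<one>\<^bsub>L2\<^esub> = {}"
  and height_one [simp]: "height \<one>\<^bsub>L2\<^esub> = 0"
  by (simp_all add: L2_def)

lemma lamps_mult: "lamps (g \<otimes>\<^bsub>L2\<^esub> h) = sym_diff (lamps g) ((\<lambda>i. height g + i) ` lamps h)"
  and height_mult [simp]: "height (g \<otimes>\<^bsub>L2\<^esub> h) = height g + height h"
  by (simp_all add: L2_def)

lemma mem_lamps_mult:
  "i \<in> lamps (g \<otimes>\<^bsub>L2\<^esub> h) \<longleftrightarrow> (i \<in> lamps g) \<noteq> (i - height g \<in> lamps h)"
proof -
  have "i \<in> (\<lambda>i. height g + i) ` lamps h \<longleftrightarrow> i - height g \<in> lamps h"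
    by (force simp: image_iff)
  then show ?thesis
    by (auto simp: lamps_mult)
qed

interpretation L2: group L2
proof (rule groupI)
  fix g
  show "\<exists>h\<in>carrier L2. h \<otimes>\<^bsub>L2\<^esub> g = \<one>\<^bsub>L2\<^esub>"
    by (rule bexI[of _ "lamp_stand ((\<lambda>i. i - height g) ` lamps g) (- height g)"])
      (auto simp: lamplighter_eq_iff lamps_mult image_image)
qed (auto simp: lamplighter_eq_iff set_eq_iff mem_lamps_mult algebra_simps)

lemma lamps_mult_a: "lamps (g \<otimes>\<^bsub>L2\<^esub> lamp_a) = sym_diff (lamps g) {height g}"
  and height_mult_a: "height (g \<otimes>\<^bsub>L2\<^esub> lamp_a) = height g"
  and lamps_mult_t: "lamps (g \<otimes>\<^bsub>L2\<^esub> lamp_t) = lamps g"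
  and height_mult_t: "height (g \<otimes>\<^bsub>L2\<^esub> lamp_t) = height g + 1"
  by (simp_all add: lamps_mult lamp_a_def lamp_t_def)

definition gens :: "lamplighter set" where
  "gens = {lamp_t, lamp_a \<otimes>\<^bsub>L2\<^esub> lamp_t}"

lemma generate_gens: "generate L2 gens = UNIV"
proof -
  let ?G = "generate L2 gens"
  have mult: "x \<otimes>\<^bsub>L2\<^esub> y \<in> ?G" if "x \<in> ?G" "y \<in> ?G" for x y
    using that by (rule generate.eng)
  have t: "lamp_t \<in> ?G" and at: "lamp_a \<otimes>\<^bsub>L2\<^esub> lamp_t \<in> ?G"
    by (auto simp: gens_def intro: generate.incl)
  have t': "inv\<^bsub>L2\<^esub> lamp_t \<in> ?G"
    by (auto simp: gens_def intro: generate.inv)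
  have "lamp_a = (lamp_a \<otimes>\<^bsub>L2\<^esub> lamp_t) \<otimes>\<^bsub>L2\<^esub> inv\<^bsub>L2\<^esub> lamp_t"
    by (simp add: L2.m_assoc)
  then have a: "lamp_a \<in> ?G"
    using mult[OF at t'] by simp
  have inv_t: "inv\<^bsub>L2\<^esub> lamp_t = lamp_stand {} (- 1)"
    by (rule L2.inv_equality)
      (auto simp: lamplighter_eq_iff lamps_mult lamp_t_def)
  have move: "lamp_stand A (k + l) \<in> ?G" if "finite A" "lamp_stand A k \<in> ?G" for A k l
  proof (induction l rule: int_induct[where k = 0])
    case base
    then show ?case using that by simp
  next
    case (step1 l)
    have "lamp_stand A (k + (l + 1)) = lamp_stand A (k + l) \<otimes>\<^bsub>L2\<^esub> lamp_t"
      using that by (auto simp: lamplighter_eq_iff lamps_mult lamp_t_def)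
    then show ?case using mult[OF step1(2) t] by simp
  next
    case (step2 l)
    have "lamp_stand A (k + (l - 1)) = lamp_stand A (k + l) \<otimes>\<^bsub>L2\<^esub> inv\<^bsub>L2\<^esub> lamp_t"
      using that by (auto simp: lamplighter_eq_iff lamps_mult inv_t)
    then show ?case using mult[OF step2(2) t'] by simp
  qed
  have "lamp_stand A k \<in> ?G" if "finite A" for A k
    using that
  proof (induction A arbitrary: k rule: finite_induct)
    case empty
    have "lamp_stand {} 0 \<in> ?G"
      using generate.one[of L2 gens] by (simp add: L2_def)
    then show ?case using move[of "{}" 0 k] by simp
  next
    case (insert p A)
    have "lamp_stand A p \<otimes>\<^bsub>L2\<^esub> lamp_a \<in> ?G"
      using insert.IH a by (rule mult)
    moreover have "lamp_stand A p \<otimes>\<^bsub>L2\<^esub> lamp_a = lamp_stand (insert p A) p"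
      using insert.hyps by (auto simp: lamplighter_eq_iff lamps_mult lamp_a_def)
    ultimately show ?case
      using move[of "insert p A" p "k - p"] insert.hyps by simp
  qed
  then have "g \<in> ?G" for g
    by (metis finite_lamps lamp_stand_collapse)
  then show ?thesis by blast
qed

text \<open>The minimum is taken over a nonempty set of lengths by \<open>generate_gens\<close>.\<close>

definition word_length :: "lamplighter \<Rightarrow> nat" where
  "word_length g = (LEAST n. \<exists>w. length w = n \<and> set w \<subseteq> gens \<union> m_inv L2 ` gens
                               \<and> foldr (mult L2) w \<one>\<^bsub>L2\<^esub> = g)"

definition word_dist :: "lamplighter \<Rightarrow> lamplighter \<Rightarrow> nat" where
  "word_dist g h = word_length (inv\<^bsub>L2\<^esub> g \<otimes>\<^bsub>L2\<^esub> h)"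

section \<open>The horofunction boundary\<close>

text \<open>As the group is discrete, every real function on it is continuous and its compact subsets
  are the finite ones.\<close>

definition compact_convergence :: "(lamplighter \<Rightarrow> real) topology" where
  "compact_convergence =
     topology_generated_by {{f. \<forall>x\<in>K. \<bar>f x - f0 x\<bar> < e} | f0 K e. finite K \<and> 0 < e}"

definition horo_embedding :: "lamplighter \<Rightarrow> lamplighter \<Rightarrow> real" where
  "horo_embedding z x = real (word_dist z x) - real (word_dist z \<one>\<^bsub>L2\<^esub>)"

definition horofunction_boundary :: "(lamplighter \<Rightarrow> real) set" where
  "horofunction_boundary =
     (compact_convergence closure_of range horo_embedding) - range horo_embedding"

text \<open>\<open>horo_limit g h\<close>: the pointwise limit defining the function attached to the sequence
  \<open>g\<close> exists everywhere and equals \<open>h\<close>.\<close>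

definition horo_limit :: "(nat \<Rightarrow> lamplighter) \<Rightarrow> (lamplighter \<Rightarrow> real) \<Rightarrow> bool" where
  "horo_limit g h \<longleftrightarrow>
     (\<forall>x. (\<lambda>n. real (word_dist (g n) x) - real (word_dist (g n) \<one>\<^bsub>L2\<^esub>)) \<longlonglongrightarrow> h x)"

section \<open>Geodesic rays\<close>

definition geodesic_ray :: "(nat \<Rightarrow> lamplighter) \<Rightarrow> bool" where
  "geodesic_ray \<gamma> \<longleftrightarrow> (\<forall>m n. real (word_dist (\<gamma> m) (\<gamma> n)) = \<bar>real m - real n\<bar>)"

definition busemann_points :: "(lamplighter \<Rightarrow> real) set" where
  "busemann_points = {h \<in> horofunction_boundary. \<exists>\<gamma>. geodesic_ray \<gamma> \<and> horo_limit \<gamma> h}"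

definition asymptotic :: "(nat \<Rightarrow> lamplighter) \<Rightarrow> (nat \<Rightarrow> lamplighter) \<Rightarrow> bool" where
  "asymptotic \<gamma> \<gamma>' \<longleftrightarrow> bdd_above (range (\<lambda>n. word_dist (\<gamma> n) (\<gamma>' n)))"

definition rays_up :: "(nat \<Rightarrow> lamplighter) set" where
  "rays_up = {\<gamma>. geodesic_ray \<gamma> \<and> \<gamma> 0 = \<one>\<^bsub>L2\<^esub> \<and> filterlim (\<lambda>n. height (\<gamma> n)) at_top sequentially}"

definition rays_down :: "(nat \<Rightarrow> lamplighter) set" where
  "rays_down = {\<gamma>. geodesic_ray \<gamma> \<and> \<gamma> 0 = \<one>\<^bsub>L2\<^esub> \<and> filterlim (\<lambda>n. height (\<gamma> n)) at_bot sequentially}"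

definition boundary_up :: "(nat \<Rightarrow> lamplighter) set set" where
  "boundary_up = rays_up // {(\<gamma>, \<gamma>'). \<gamma> \<in> rays_up \<and> \<gamma>' \<in> rays_up \<and> asymptotic \<gamma> \<gamma>'}"

definition boundary_down :: "(nat \<Rightarrow> lamplighter) set set" where
  "boundary_down =
     rays_down // {(\<gamma>, \<gamma>'). \<gamma> \<in> rays_down \<and> \<gamma>' \<in> rays_down \<and> asymptotic \<gamma> \<gamma>'}"

definition ray_lamps :: "(nat \<Rightarrow> lamplighter) \<Rightarrow> int set" where
  "ray_lamps \<gamma> = {i. eventually (\<lambda>n. i \<in> lamps (\<gamma> n)) sequentially}"

section \<open>The families of horofunctions\<close>

text \<open>Lowest and highest position in a set of lamps. The values for the empty set are
  \<open>\<infinity>\<close> and \<open>-\<infinity>\<close>; a nonempty set of integers bounded below (above) attains its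
  infimum (supremum).\<close>

definition lowest :: "int set \<Rightarrow> ereal" where
  "lowest A = (INF i\<in>A. ereal (of_int i))"

definition highest :: "int set \<Rightarrow> ereal" where
  "highest A = (SUP i\<in>A. ereal (of_int i))"

lemma lowest_empty: "lowest {} = \<infinity>" and highest_empty: "highest {} = -\<infinity>"
  by (simp_all add: lowest_def highest_def top_ereal_def bot_ereal_def)

lemma lowest_eq: "i \<in> A \<Longrightarrow> (\<And>j. j \<in> A \<Longrightarrow> i \<le> j) \<Longrightarrow> lowest A = ereal (of_int i)"
  unfolding lowest_def by (intro antisym INF_lower INF_greatest) auto

lemma highest_eq: "i \<in> A \<Longrightarrow> (\<And>j. j \<in> A \<Longrightarrow> j \<le> i) \<Longrightarrow> highest A = ereal (of_int i)"
  unfolding highest_def by (intro antisym SUP_upper SUP_least) auto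

text \<open>The lamps whose status differs in two configurations form their symmetric difference.
  The configuration of a ray going up (down) is bounded below (above), so every minimum and maximum
  converted to a real number below is finite.\<close>

definition b_up :: "(nat \<Rightarrow> lamplighter) \<Rightarrow> lamplighter \<Rightarrow> real" where
  "b_up \<gamma> g =
     2 * (real_of_ereal (min (lowest (ray_lamps \<gamma>)) 0)
          - real_of_ereal (min (lowest (sym_diff (ray_lamps \<gamma>) (lamps g))) (of_int (height g))))
     + of_int (height g)"

definition b_down :: "(nat \<Rightarrow> lamplighter) \<Rightarrow> lamplighter \<Rightarrow> real" where
  "b_down \<gamma> g =
     2 * (real_of_ereal (max (highest (sym_diff (ray_lamps \<gamma>) (lamps g)) + 1) (of_int (height g)))
          - real_of_ereal (max (highest (ray_lamps \<gamma>) + 1) 0))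
     - of_int (height g)"

definition spine :: "int \<Rightarrow> lamplighter \<Rightarrow> real" where
  "spine l g = of_int (\<bar>l\<bar> - \<bar>l - height g\<bar>)"

definition rib_up :: "lamplighter \<Rightarrow> lamplighter \<Rightarrow> real" where
  "rib_up f g =
     2 * (real_of_ereal (min (lowest (lamps f)) (min (of_int (height f)) 0))
          - real_of_ereal (min (lowest (sym_diff (lamps f) (lamps g)))
                               (min (of_int (height g)) (of_int (height f)))))
     + spine (height f) g"

definition rib_down :: "lamplighter \<Rightarrow> lamplighter \<Rightarrow> real" where
  "rib_down f g =
     2 * (real_of_ereal (max (highest (sym_diff (lamps f) (lamps g)) + 1)
                             (max (of_int (height g)) (of_int (height f))))
          - real_of_ereal (max (highest (lamps f) + 1) (max (of_int (height f)) 0)))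
     + spine (height f) g"

definition busemann_family :: "(lamplighter \<Rightarrow> real) set" where
  "busemann_family = {b_up \<gamma> | \<gamma> c. c \<in> boundary_up \<and> \<gamma> \<in> c}
                   \<union> {b_down \<gamma> | \<gamma> c. c \<in> boundary_down \<and> \<gamma> \<in> c}"

definition spine_family :: "(lamplighter \<Rightarrow> real) set" where
  "spine_family = range spine"

definition rib_family :: "(lamplighter \<Rightarrow> real) set" where
  "rib_family = {rib_up f | f. highest (lamps f) < of_int (height f)}
              \<union> {rib_down f | f. lowest (lamps f) \<ge> of_int (height f)}"

definition height_family :: "(lamplighter \<Rightarrow> real) set" where
  "height_family = {\<lambda>g. of_int (height g), \<lambda>g. - of_int (height g)}"

definition all_lamps :: "(nat \<Rightarrow> lamplighter) \<Rightarrow> int set" where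
  "all_lamps g = (\<Union>n. lamps (g n))"

end

theory Submission
  imports Defs
begin

text \<open>A generator moves the lamplighter along one edge \<open>[i, i + 1]\<close> and may switch the lamp \<open>i\<close> on the
  way. A geodesic from \<open>z\<close> to \<open>x\<close> therefore sweeps the interval from the lowest to the highest
  position among the two heights and the lamps to be switched, and \<open>d(z, x)\<close> is twice the length
  of that interval minus \<open>\<bar>H(z) - H(x)\<bar>\<close>. Along a sequence the upper end, the lower end and the
  height each become constant or infinite on a subsequence. An end that goes to infinity cancels in
  \<open>d(z, x) - d(z, id)\<close>, an end that stays bounded remembers the limiting lamp configuration, and the
  possible combinations are exactly the four families.

  A geodesic ray lowers its limit function by one at each step, whereas the limit of a sequence that
  stays at one height is bounded below on the elements of that height, and a height function cannot
  drop while the height rises; so a Busemann function comes from a ray whose height tends to plus or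
  minus infinity. The isometry \<open>mirror\<close> exchanges the two directions.\<close>

section \<open>Ends of swept intervals\<close>

text \<open>Distances are integers, so limits are established as eventual equalities, and
  \<open>cocycle_eq\<close> splits d(z, x) - d(z, id) into parts that can be followed separately.
  The topology is only given by a subbasis; countability of the group makes its closure sequential,
  and passing to subsequences costs nothing because the limit \<open>h\<close> is already fixed.
  What the analysis of a sequence delivers is a bare set \<open>L\<close> of integers bounded on one
  side, not a ray. Two bridges close this gap: the lamps along a ray converge to the set found for
  its limit, and every such set is realised by a ray from the identity. Points of the group itself
  are excluded by one criterion: \<open>horo_embedding z\<close> is bounded below by - d(z, id),
  whereas every member of the four families is unbounded below.\<close>

text \<open>The integer form of min{m(A), k}: inserting \<open>k\<close> keeps the set nonempty, so
  no infinite value occurs. \<open>Inf\<close> is meaningful only for sets bounded below, hence the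
  boundedness hypotheses.\<close>

definition lower_end :: "int set \<Rightarrow> int \<Rightarrow> int" where
  "lower_end A k = Inf (insert k A)"

text \<open>The lamp \<open>i\<close> belongs to the edge \<open>[i, i + 1]\<close>, whose mirror image is \<open>[- 1 - i, - i]\<close>. So
  \<open>upper_end A k\<close> is the maximum of \<open>k\<close> and all \<open>i + 1\<close> with \<open>i \<in> A\<close>.\<close>

definition reflect :: "int set \<Rightarrow> int set" where
  "reflect A = (\<lambda>i. - 1 - i) ` A"

definition upper_end :: "int set \<Rightarrow> int \<Rightarrow> int" where
  "upper_end A k = - lower_end (reflect A) (- k)"

lemma mem_reflect [simp]: "i \<in> reflect A \<longleftrightarrow> - 1 - i \<in> A"
  by (force simp: reflect_def image_iff)

lemma reflect_reflect [simp]: "reflect (reflect A) = A"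
  by (auto simp: set_eq_iff)

lemma reflect_sym_diff: "reflect (sym_diff A B) = sym_diff (reflect A) (reflect B)"
  by auto

lemma finite_reflect [simp]: "finite (reflect A) \<longleftrightarrow> finite A"
  by (metis finite_imageI reflect_def reflect_reflect)

lemma bdd_below_reflect [simp]: "bdd_below (reflect A) \<longleftrightarrow> bdd_above A"
proof
  assume "bdd_below (reflect A)"
  then obtain b where b: "\<And>i. i \<in> reflect A \<Longrightarrow> b \<le> i" unfolding bdd_below_def by blast
  have "i \<le> - 1 - b" if "i \<in> A" for i
    using b[of "- 1 - i"] that by simp
  then show "bdd_above A" by (auto simp: bdd_above_def)
next
  assume "bdd_above A"
  then obtain b where b: "\<And>i. i \<in> A \<Longrightarrow> i \<le> b" unfolding bdd_above_def by blast
  have "- 1 - b \<le> i" if "i \<in> reflect A" for i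
    using b[of "- 1 - i"] that by simp
  then show "bdd_below (reflect A)" by (rule bdd_belowI)
qed

lemma bdd_above_reflect [simp]: "bdd_above (reflect A) \<longleftrightarrow> bdd_below A"
  by (metis bdd_below_reflect reflect_reflect)

lemma le_lower_end_iff:
  "bdd_below A \<Longrightarrow> c \<le> lower_end A k \<longleftrightarrow> c \<le> k \<and> (\<forall>i\<in>A. c \<le> i)"
  unfolding lower_end_def by (subst le_cInf_iff) auto

lemma upper_end_le_iff:
  assumes "bdd_above A"
  shows "upper_end A k \<le> c \<longleftrightarrow> k \<le> c \<and> (\<forall>i\<in>A. i < c)"
proof -
  have "upper_end A k \<le> c \<longleftrightarrow> - c \<le> lower_end (reflect A) (- k)"
    by (auto simp: upper_end_def)
  also have "\<dots> \<longleftrightarrow> k \<le> c \<and> (\<forall>i\<in>reflect A. - c \<le> i)"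
    using assms by (simp add: le_lower_end_iff)
  also have "(\<forall>i\<in>reflect A. - c \<le> i) \<longleftrightarrow> (\<forall>i\<in>A. i < c)"
    by (force simp: reflect_def)
  finally show ?thesis .
qed

lemma lower_end_le: "bdd_below A \<Longrightarrow> lower_end A k \<le> k"
  and lower_end_le_mem: "bdd_below A \<Longrightarrow> i \<in> A \<Longrightarrow> lower_end A k \<le> i"
  using le_lower_end_iff[of A "lower_end A k" k] by auto

lemma upper_end_ge: "bdd_above A \<Longrightarrow> k \<le> upper_end A k"
  and upper_end_gt_mem: "bdd_above A \<Longrightarrow> i \<in> A \<Longrightarrow> i < upper_end A k"
  using upper_end_le_iff[of A k "upper_end A k"] by auto

text \<open>Discreteness of the integers: otherwise the successor of the end would still be a lower
  bound.\<close>

lemma lower_end_attained: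
  assumes "bdd_below A"
  shows "lower_end A k = k \<or> lower_end A k \<in> A"
proof (rule ccontr)
  assume *: "\<not> (lower_end A k = k \<or> lower_end A k \<in> A)"
  have "lower_end A k + 1 \<le> k"
    using * lower_end_le[OF assms, of k] by linarith
  moreover have "lower_end A k + 1 \<le> i" if "i \<in> A" for i
    using * lower_end_le_mem[OF assms that, of k] that by (metis order_le_less zless_imp_add1_zle)
  ultimately have "lower_end A k + 1 \<le> lower_end A k"
    using le_lower_end_iff[OF assms, of "lower_end A k + 1" k] by blast
  then show False by simp
qed

text \<open>Locality: an end below \<open>c\<close> is determined by the data below
  \<open>c\<close>. Its attained value transfers to the other side, which puts the second end below
  \<open>c\<close> too, so the argument runs back. The reference points may differ only if both are
  at least \<open>c\<close>.\<close>

lemma lower_end_cong_below: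
  assumes A: "bdd_below A" and B: "bdd_below B"
    and mem: "\<And>i. i < c \<Longrightarrow> i \<in> A \<longleftrightarrow> i \<in> B" and kl: "k < c \<or> l < c \<Longrightarrow> k = l"
    and less: "lower_end A k < c"
  shows "lower_end B l = lower_end A k"
proof (rule antisym)
  show le: "lower_end B l \<le> lower_end A k"
    using lower_end_attained[OF A, of k]
  proof
    assume "lower_end A k = k"
    then show ?thesis using less kl lower_end_le[OF B, of l] by simp
  next
    assume "lower_end A k \<in> A"
    then show ?thesis using less mem lower_end_le_mem[OF B] by blast
  qed
  show "lower_end A k \<le> lower_end B l"
    using lower_end_attained[OF B, of l]
  proof
    assume "lower_end B l = l"
    then show ?thesis using le less kl lower_end_le[OF A, of k] by simp
  next
    assume "lower_end B l \<in> B"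
    then show ?thesis using le less mem lower_end_le_mem[OF A] by simp
  qed
qed

lemma lower_end_empty [simp]: "lower_end {} k = k"
  by (simp add: lower_end_def)

lemma upper_end_empty [simp]: "upper_end {} k = k"
  by (simp add: upper_end_def reflect_def)

section \<open>The word metric\<close>

abbreviation diff_lamps :: "lamplighter \<Rightarrow> lamplighter \<Rightarrow> int set" where
  "diff_lamps g h \<equiv> sym_diff (lamps g) (lamps h)"

definition low :: "lamplighter \<Rightarrow> lamplighter \<Rightarrow> int" where
  "low g h = lower_end (diff_lamps g h) (min (height g) (height h))"

definition high :: "lamplighter \<Rightarrow> lamplighter \<Rightarrow> int" where
  "high g h = upper_end (diff_lamps g h) (max (height g) (height h))"

text \<open>A shortest walk of the lamplighter from \<open>g\<close> to \<open>h\<close> has to cover the interval from \<open>low g h\<close> to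
  \<open>high g h\<close>, twice except for the part between the two heights.\<close>

definition travel :: "lamplighter \<Rightarrow> lamplighter \<Rightarrow> int" where
  "travel g h = 2 * (high g h - low g h) - \<bar>height g - height h\<bar>"

lemma finite_bdd [simp]: "finite (A :: int set) \<Longrightarrow> bdd_below A" "finite (A :: int set) \<Longrightarrow> bdd_above A"
  by (auto intro: bdd_below_finite bdd_above_finite)

section \<open>Edges of the Cayley graph\<close>

definition letters :: "lamplighter set" where
  "letters = gens \<union> m_inv L2 ` gens"

lemma inv_L2: "inv\<^bsub>L2\<^esub> g = lamp_stand ((\<lambda>i. i - height g) ` lamps g) (- height g)"
  by (rule L2.inv_equality) (auto simp: lamplighter_eq_iff lamps_mult image_image)

text \<open>The inverse of a t steps down and then toggles the lamp it arrives at. So in either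
  direction a letter touches only the lamp at the lower endpoint of the edge it crosses.\<close>

lemma letters_iff:
  "s \<in> letters \<longleftrightarrow> \<bar>height s\<bar> = 1 \<and> lamps s \<subseteq> {min 0 (height s)}"
proof -
  have 1: "letters = {lamp_stand {} 1, lamp_stand {0} 1, lamp_stand {} (- 1), lamp_stand {- 1} (- 1)}"
    by (auto simp: letters_def gens_def inv_L2 lamplighter_eq_iff lamps_mult lamp_a_def lamp_t_def)
  have 2: "\<bar>k\<bar> = 1 \<longleftrightarrow> k = 1 \<or> k = - 1" for k :: int by arith
  show ?thesis
    unfolding 1 2 by (cases "height s = 1"; cases "height s = - 1") (simp_all add: lamplighter_eq_iff subset_singleton_iff)
qed

text \<open>The edge relation of the Cayley graph, written without multiplication so that symmetry
  and invariance under reflection can be read off.\<close>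

definition adjacent :: "lamplighter \<Rightarrow> lamplighter \<Rightarrow> bool" where
  "adjacent g h \<longleftrightarrow> \<bar>height g - height h\<bar> = 1 \<and> diff_lamps g h \<subseteq> {min (height g) (height h)}"

lemma diff_lamps_mult: "diff_lamps g (g \<otimes>\<^bsub>L2\<^esub> s) = (\<lambda>i. height g + i) ` lamps s"
  by (auto simp: lamps_mult)

lemma adjacent_mult: "adjacent g (g \<otimes>\<^bsub>L2\<^esub> s) \<longleftrightarrow> s \<in> letters"
proof -
  have "min (height g) (height g + height s) = height g + min 0 (height s)" by simp
  then show ?thesis
    unfolding adjacent_def letters_iff diff_lamps_mult by auto
qed

lemma adjacent_sym: "adjacent g h \<Longrightarrow> adjacent h g"
  unfolding adjacent_def by (simp add: Un_commute min.commute abs_minus_commute)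

lemma low_commute: "low g h = low h g"
  by (simp add: low_def Un_commute min.commute)

lemma high_commute: "high g h = high h g"
  by (simp add: high_def Un_commute max.commute)

lemma travel_commute: "travel g h = travel h g"
  by (simp add: travel_def low_commute high_commute abs_minus_commute)

lemma le_low_iff:
  "c \<le> low g h \<longleftrightarrow> c \<le> height g \<and> c \<le> height h \<and> (\<forall>i. (i \<in> lamps g) \<noteq> (i \<in> lamps h) \<longrightarrow> c \<le> i)"
  unfolding low_def by (subst le_lower_end_iff) auto

lemma high_le_iff:
  "high g h \<le> c \<longleftrightarrow> height g \<le> c \<and> height h \<le> c \<and> (\<forall>i. (i \<in> lamps g) \<noteq> (i \<in> lamps h) \<longrightarrow> i < c)"
  unfolding high_def by (subst upper_end_le_iff) auto

lemma low_le: "low g h \<le> height g" "low g h \<le> height h"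
  "(i \<in> lamps g) \<noteq> (i \<in> lamps h) \<Longrightarrow> low g h \<le> i"
  using le_low_iff[of "low g h" g h] by auto

lemma high_ge: "height g \<le> high g h" "height h \<le> high g h"
  "(i \<in> lamps g) \<noteq> (i \<in> lamps h) \<Longrightarrow> i < high g h"
  using high_le_iff[of g h "high g h"] by auto

lemma travel_nonneg: "0 \<le> travel g h"
  using low_le(1,2)[of g h] high_ge(1)[of g h] high_ge(2)[of h g] by (simp add: travel_def abs_if)

lemma travel_eq_0_iff: "travel g h = 0 \<longleftrightarrow> g = h"
proof
  assume "travel g h = 0"
  then have "high g h = low g h"
    using low_le(1,2)[of g h] high_ge(1)[of g h] high_ge(2)[of h g] by (auto simp: travel_def abs_if split: if_splits)
  then show "g = h"
    using low_le(1,2)[of g h] high_ge(1)[of g h] high_ge(2)[of h g] low_le(3)[of _ g h] high_ge(3)[of _ g h]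
    by (fastforce simp: lamplighter_eq_iff)
qed (simp add: travel_def low_def high_def)

text \<open>Crossing the edge above \<open>height g\<close> alters at most the lamp at
  \<open>height g\<close>. An end moves only if it sits at \<open>height g\<close>: the lower one is
  released when the target lies above, the upper one is pushed when it does not.\<close>

lemma low_high_adjacent:
  assumes "adjacent g k" "height k = height g + 1"
  shows "low k h = low g h \<or> (height g < height h \<and> low g h = height g \<and> low k h = height g + 1)"
    and "high k h = high g h \<or> (height h \<le> height g \<and> high g h = height g \<and> high k h = height g + 1)"
proof -
  have D: "(i \<in> lamps g) = (i \<in> lamps k)" if "i \<noteq> height g" for i
    using assms that by (auto simp: adjacent_def)
  \<comment> \<open>A bound \<open>c\<close> in this range is violated neither by the toggled lamp
    nor by the new height.\<close>
  have A: "c \<le> low k h \<longleftrightarrow> c \<le> low g h" if "c \<le> height g" for c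
  proof -
    have "((i \<in> lamps k) \<noteq> (i \<in> lamps h) \<longrightarrow> c \<le> i) \<longleftrightarrow> ((i \<in> lamps g) \<noteq> (i \<in> lamps h) \<longrightarrow> c \<le> i)" for i
      using D[of i] that by (cases "i = height g") auto
    then show ?thesis using that assms(2) unfolding le_low_iff by simp
  qed
  \<comment> \<open>The bound must be strict because the lamp at \<open>height g\<close> occupies
    the edge up to \<open>height g + 1\<close>.\<close>
  have B: "high k h \<le> c \<longleftrightarrow> high g h \<le> c" if "height g < c" for c
  proof -
    have "((i \<in> lamps k) \<noteq> (i \<in> lamps h) \<longrightarrow> i < c) \<longleftrightarrow> ((i \<in> lamps g) \<noteq> (i \<in> lamps h) \<longrightarrow> i < c)" for i
      using D[of i] that by (cases "i = height g") auto
    then show ?thesis using that assms(2) unfolding high_le_iff by simp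
  qed
  have C: "low k h \<le> height g \<Longrightarrow> low k h = low g h"
    using A[of "low k h"] A[of "low g h"] low_le(1)[of g h] by linarith
  have E: "low k h \<le> height g + 1" using low_le(1)[of k h] assms by linarith
  show "low k h = low g h \<or> (height g < height h \<and> low g h = height g \<and> low k h = height g + 1)"
    using C E A[of "height g"] low_le(2)[of k h] low_le(1)[of g h] by linarith
  have F: "height g + 1 \<le> high k h" using high_ge(1)[of k h] assms by linarith
  have G: "high g h > height g \<Longrightarrow> high k h = high g h"
    using B[of "high k h"] B[of "high g h"] F by linarith
  show "high k h = high g h \<or> (height h \<le> height g \<and> high g h = height g \<and> high k h = height g + 1)"
    using G F high_ge(1)[of g h] high_ge(2)[of h g] B[of "height g + 1"] by linarith
qed

text \<open>Moving away from the target height changes the last term of \<open>travel\<close> by -1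
  and the upper end contributes 0 or 2; moving towards it changes that term by 1 and the lower end
  contributes 0 or -2.\<close>

lemma travel_adjacent_up:
  assumes "adjacent g k" "height k = height g + 1"
  shows "\<bar>travel g h - travel k h\<bar> = 1"
proof (cases "height h \<le> height g")
  case True
  then have "low k h = low g h" "high k h = high g h \<or> high k h = high g h + 1"
    using low_high_adjacent[OF assms, of h] by linarith+
  then show ?thesis using True assms(2) unfolding travel_def by (elim disjE) simp_all
next
  case False
  then have "high k h = high g h" "low k h = low g h \<or> low k h = low g h + 1"
    using low_high_adjacent[OF assms, of h] by linarith+
  then show ?thesis using False assms(2) unfolding travel_def by (elim disjE) simp_all
qed

lemma travel_adjacent:
  assumes "adjacent g k"
  shows "\<bar>travel g h - travel k h\<bar> = 1"
proof -
  have "height k = height g + 1 \<or> height g = height k + 1"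
    using assms by (auto simp: adjacent_def)
  then show ?thesis
    using travel_adjacent_up[OF assms, of h] travel_adjacent_up[OF adjacent_sym[OF assms], of h]
    by linarith
qed

section \<open>Reflection of the line\<close>

text \<open>This is the automorphism inverting both generators: a t has lamp 0 and height 1, its
  image has lamp -1 and height -1, which is its inverse.\<close>

definition mirror :: "lamplighter \<Rightarrow> lamplighter" where
  "mirror g = lamp_stand (reflect (lamps g)) (- height g)"

lemma lamps_mirror [simp]: "lamps (mirror g) = reflect (lamps g)"
  and height_mirror [simp]: "height (mirror g) = - height g"
  by (simp_all add: mirror_def)

lemma mirror_mirror [simp]: "mirror (mirror g) = g"
  by (simp add: lamplighter_eq_iff)

lemma mirror_one [simp]: "mirror \<one>\<^bsub>L2\<^esub> = \<one>\<^bsub>L2\<^esub>"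
  by (simp add: lamplighter_eq_iff reflect_def)

lemma high_eq_low_mirror: "high g h = - low (mirror g) (mirror h)"
proof -
  have "- max (height g) (height h) = min (- height g) (- height h)" by simp
  then show ?thesis
    by (simp add: high_def low_def upper_end_def flip: reflect_sym_diff)
qed

lemma high_mirror: "high (mirror g) (mirror h) = - low g h"
  by (simp add: high_eq_low_mirror)

lemma travel_mirror: "travel (mirror g) (mirror h) = travel g h"
  using high_eq_low_mirror[of g h] high_mirror[of g h] by (simp add: travel_def)

lemma adjacent_mirror:
  assumes "adjacent g h"
  shows "adjacent (mirror g) (mirror h)"
proof -
  have "i = min (- height g) (- height h)" if "i \<in> diff_lamps (mirror g) (mirror h)" for i
  proof -
    have "- 1 - i = min (height g) (height h)"
      using assms that by (auto simp: adjacent_def)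
    moreover have "\<bar>height g - height h\<bar> = 1"
      using assms by (simp add: adjacent_def)
    ultimately show ?thesis by linarith
  qed
  moreover have "\<bar>- height g + height h\<bar> = 1"
    using assms unfolding adjacent_def by linarith
  ultimately show ?thesis
    unfolding adjacent_def by auto
qed

section \<open>Shortest walks\<close>

text \<open>The greedy walk towards a target that is not lower: first go down to the lower end, then
  ascend and settle each lamp on leaving it; overshoot the target height only once nothing remains
  below.\<close>

lemma travel_decreasing_step_up:
  assumes "g \<noteq> h" "height g \<le> height h"
  shows "\<exists>k. adjacent g k \<and> travel k h = travel g h - 1"
proof -
  consider "low g h < height g" | "low g h = height g" "height g < height h"
    | "low g h = height g" "height g = height h"
    using assms(2) low_le(1)[of g h] by linarith
  then show ?thesis
  proof cases
    case 1
    \<comment> \<open>The lamp on the edge crossed downwards can wait, since the walk has to come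
      back up over it.\<close>
    define k where "k = lamp_stand (lamps g) (height g - 1)"
    have k: "height g = height k + 1" and adj: "adjacent k g"
      by (simp_all add: k_def adjacent_def)
    have "low g h = low k h" "high g h = high k h"
      using low_high_adjacent[OF adj k, of h] 1 assms(2) k by auto
    then have "travel k h = travel g h - 1"
      using assms(2) k by (simp add: travel_def)
    then show ?thesis using adjacent_sym[OF adj] by blast
  next
    case 2
    \<comment> \<open>The edge is not crossed again, so its lamp gets its final status now; this
      lets the lower end rise.\<close>
    define k where
      "k = lamp_stand (lamps g - {height g} \<union> lamps h \<inter> {height g}) (height g + 1)"
    have mem: "i \<in> lamps k \<longleftrightarrow> (if i = height g then i \<in> lamps h else i \<in> lamps g)" for i
      by (auto simp: k_def)
    have k: "height k = height g + 1" by (simp add: k_def)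
    have adj: "adjacent g k"
      using k by (auto simp: adjacent_def mem split: if_splits)
    have "height g + 1 \<le> i" if "(i \<in> lamps k) \<noteq> (i \<in> lamps h)" for i
      using that low_le(3)[of i g h] 2(1) by (cases "i = height g") (simp_all add: mem)
    then have "height g + 1 \<le> low k h"
      using 2(2) k unfolding le_low_iff by simp
    then have "low k h = low g h + 1" "high k h = high g h"
      using low_high_adjacent[OF adj k, of h] 2 by auto
    then have "travel k h = travel g h - 1"
      using 2 k by (simp add: travel_def)
    then show ?thesis using adj by blast
  next
    case 3
    \<comment> \<open>Heights agree and nothing lies below, so \<open>g \<noteq> h\<close> forces
      work above. The lamp on this edge is left for the return.\<close>
    define k where "k = lamp_stand (lamps g) (height g + 1)"
    have k: "height k = height g + 1" and adj: "adjacent g k"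
      by (simp_all add: k_def adjacent_def)
    have "high g h \<noteq> height g"
      using assms(1) 3 travel_eq_0_iff[of g h] by (auto simp: travel_def)
    then have "low k h = low g h" "high k h = high g h"
      using low_high_adjacent[OF adj k, of h] 3 by auto
    then have "travel k h = travel g h - 1"
      using 3 k by (simp add: travel_def)
    then show ?thesis using adj by blast
  qed
qed

lemma travel_decreasing_step:
  assumes "g \<noteq> h"
  shows "\<exists>k. adjacent g k \<and> travel k h = travel g h - 1"
proof (cases "height g \<le> height h")
  case True
  then show ?thesis using assms travel_decreasing_step_up by blast
next
  case False
  then have "mirror g \<noteq> mirror h" "height (mirror g) \<le> height (mirror h)"
    using assms by (metis mirror_mirror, simp)
  then obtain k where k: "adjacent (mirror g) k" "travel k (mirror h) = travel (mirror g) (mirror h) - 1"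
    using travel_decreasing_step_up by blast
  have "adjacent g (mirror k)"
    using adjacent_mirror[OF k(1)] by simp
  moreover have "travel (mirror k) h = travel g h - 1"
    using k(2) travel_mirror[of "mirror k" h] by (simp add: travel_mirror)
  ultimately show ?thesis by blast
qed

text \<open>By \<open>travel_adjacent\<close> each letter lowers the \<open>travel\<close> left to
  the endpoint by at most one, and nothing is left after the last letter.\<close>

lemma travel_le_word:
  "set w \<subseteq> letters \<Longrightarrow> travel g (g \<otimes>\<^bsub>L2\<^esub> foldr (mult L2) w \<one>\<^bsub>L2\<^esub>) \<le> int (length w)"
proof (induction w arbitrary: g)
  case Nil
  show ?case using travel_eq_0_iff[of g g] by simp
next
  case (Cons s w)
  let ?v = "foldr (mult L2) w \<one>\<^bsub>L2\<^esub>"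
  have "\<bar>travel g (g \<otimes>\<^bsub>L2\<^esub> s \<otimes>\<^bsub>L2\<^esub> ?v) - travel (g \<otimes>\<^bsub>L2\<^esub> s) (g \<otimes>\<^bsub>L2\<^esub> s \<otimes>\<^bsub>L2\<^esub> ?v)\<bar> = 1"
    by (rule travel_adjacent) (use Cons.prems in \<open>simp add: adjacent_mult\<close>)
  moreover have "travel (g \<otimes>\<^bsub>L2\<^esub> s) (g \<otimes>\<^bsub>L2\<^esub> s \<otimes>\<^bsub>L2\<^esub> ?v) \<le> int (length w)"
    using Cons by simp
  moreover have "g \<otimes>\<^bsub>L2\<^esub> foldr (mult L2) (s # w) \<one>\<^bsub>L2\<^esub> = g \<otimes>\<^bsub>L2\<^esub> s \<otimes>\<^bsub>L2\<^esub> ?v"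
    by (simp add: L2.m_assoc)
  ultimately show ?case by simp
qed

lemma word_of_travel:
  "travel g h = int n \<Longrightarrow>
    \<exists>w. length w = n \<and> set w \<subseteq> letters \<and> g \<otimes>\<^bsub>L2\<^esub> foldr (mult L2) w \<one>\<^bsub>L2\<^esub> = h"
proof (induction n arbitrary: g)
  case 0
  then have "g = h" using travel_eq_0_iff by simp
  then show ?case by simp
next
  case (Suc n)
  then have "g \<noteq> h" using travel_eq_0_iff[of g h] by auto
  then obtain k where k: "adjacent g k" "travel k h = travel g h - 1"
    using travel_decreasing_step by blast
  then obtain w where w: "length w = n" "set w \<subseteq> letters" "k \<otimes>\<^bsub>L2\<^esub> foldr (mult L2) w \<one>\<^bsub>L2\<^esub> = h"
    using Suc by auto
  define s where "s = inv\<^bsub>L2\<^esub> g \<otimes>\<^bsub>L2\<^esub> k"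
  have s: "g \<otimes>\<^bsub>L2\<^esub> s = k" by (simp add: s_def flip: L2.m_assoc)
  then have "s \<in> letters" using k(1) adjacent_mult by metis
  moreover have "g \<otimes>\<^bsub>L2\<^esub> foldr (mult L2) (s # w) \<one>\<^bsub>L2\<^esub> = h"
    using w(3) s by (simp flip: L2.m_assoc)
  ultimately show ?case using w by (intro exI[of _ "s # w"]) auto
qed

theorem word_dist_eq_travel: "int (word_dist g h) = travel g h"
proof -
  \<comment> \<open>It remains to translate words for the quotient of \<open>g\<close> and
    \<open>h\<close> into walks from \<open>g\<close> to \<open>h\<close>, for which both bounds are
    known.\<close>
  obtain n where n: "travel g h = int n"
    using travel_nonneg nonneg_int_cases by metis
  have shift: "v = inv\<^bsub>L2\<^esub> g \<otimes>\<^bsub>L2\<^esub> h \<longleftrightarrow> g \<otimes>\<^bsub>L2\<^esub> v = h" for v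
    by (auto simp flip: L2.m_assoc)
  have "word_dist g h = n"
    unfolding word_dist_def word_length_def letters_def[symmetric] shift
  proof (rule Least_equality)
    show "\<exists>w. length w = n \<and> set w \<subseteq> letters \<and> g \<otimes>\<^bsub>L2\<^esub> foldr (mult L2) w \<one>\<^bsub>L2\<^esub> = h"
      using word_of_travel[OF n] .
  next
    fix m
    assume "\<exists>w. length w = m \<and> set w \<subseteq> letters \<and> g \<otimes>\<^bsub>L2\<^esub> foldr (mult L2) w \<one>\<^bsub>L2\<^esub> = h"
    then show "n \<le> m" using travel_le_word n by (metis of_nat_le_iff)
  qed
  then show ?thesis using n by simp
qed

lemma word_dist_refl [simp]: "word_dist g g = 0"
  using word_dist_eq_travel[of g g] travel_eq_0_iff[of g g] by simp

lemma word_dist_mirror: "word_dist (mirror g) (mirror h) = word_dist g h"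
  by (metis of_nat_eq_iff travel_mirror word_dist_eq_travel)

text \<open>Concatenating shortest words avoids comparing three pairs of minima and maxima.\<close>

lemma travel_triangle: "travel g k \<le> travel g h + travel h k"
proof -
  obtain n m where n: "travel g h = int n" and m: "travel h k = int m"
    using travel_nonneg nonneg_int_cases by metis
  obtain v where v: "length v = n" "set v \<subseteq> letters" "g \<otimes>\<^bsub>L2\<^esub> foldr (mult L2) v \<one>\<^bsub>L2\<^esub> = h"
    using word_of_travel[OF n] by blast
  obtain w where w: "length w = m" "set w \<subseteq> letters" "h \<otimes>\<^bsub>L2\<^esub> foldr (mult L2) w \<one>\<^bsub>L2\<^esub> = k"
    using word_of_travel[OF m] by blast
  have "g \<otimes>\<^bsub>L2\<^esub> foldr (mult L2) (v @ w) \<one>\<^bsub>L2\<^esub> = h \<otimes>\<^bsub>L2\<^esub> foldr (mult L2) w \<one>\<^bsub>L2\<^esub>"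
    unfolding v(3)[symmetric] by (induction v arbitrary: g) (simp_all flip: L2.m_assoc)
  then show ?thesis
    using travel_le_word[of "v @ w" g] v w n m by simp
qed

section \<open>Horofunctions as sequential limits\<close>

text \<open>Serves both the sequential description of the closure and the countability of the
  ribs.\<close>

lemma countable_lamplighter: "countable (UNIV :: lamplighter set)"
proof -
  have "(UNIV :: lamplighter set) = (\<lambda>(A, k). lamp_stand A k) ` ({A. finite A} \<times> UNIV)"
    by (auto simp: image_iff) (metis finite_lamps lamp_stand_collapse)
  moreover have "countable ({A :: int set. finite A} \<times> (UNIV :: int set))"
    by (intro countable_SIGMA uncountable_def countable_Collect_finite) auto
  ultimately show ?thesis by (metis countable_image)
qed

lemma horo_limit_iff: "horo_limit g h \<longleftrightarrow> (\<forall>x. (\<lambda>n. horo_embedding (g n) x) \<longlonglongrightarrow> h x)"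
  by (simp add: horo_limit_def horo_embedding_def)

lemma horo_limit_unique: "horo_limit g h \<Longrightarrow> horo_limit g h' \<Longrightarrow> h = h'"
  unfolding horo_limit_iff by (meson LIMSEQ_unique ext)

lemma horo_limit_subseq: "horo_limit g h \<Longrightarrow> strict_mono r \<Longrightarrow> horo_limit (g \<circ> r) h"
  unfolding horo_limit_iff using LIMSEQ_subseq_LIMSEQ by (fastforce simp: o_def)

text \<open>Induction on the generation of open sets from the subbasis. A subbasic set constrains
  finitely many points, so pointwise convergence suffices.\<close>

lemma horo_limit_openin:
  assumes "horo_limit g h" "openin compact_convergence T" "h \<in> T"
  shows "eventually (\<lambda>n. horo_embedding (g n) \<in> T) sequentially"
proof -
  let ?B = "{{f. \<forall>x\<in>K. \<bar>f x - f0 x\<bar> < e} | f0 K (e::real). finite K \<and> 0 < e}"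
  have "generate_topology_on ?B T"
    using assms(2) by (simp add: compact_convergence_def openin_topology_generated_by_iff)
  then show ?thesis using assms(3)
  proof induction
    case (UN \<K>)
    then obtain k where "k \<in> \<K>" "h \<in> k" by blast
    with UN.IH[of k] show ?case by (auto elim!: eventually_mono)
  next
    case (Basis s)
    then obtain f0 K and e :: real where s: "s = {f. \<forall>x\<in>K. \<bar>f x - f0 x\<bar> < e}" "finite K"
      by blast
    have "eventually (\<lambda>n. \<bar>horo_embedding (g n) x - f0 x\<bar> < e) sequentially" if "x \<in> K" for x
    \<comment> \<open>The centre \<open>f0\<close> need not be \<open>h\<close>; the strict
      inequality at \<open>h\<close> leaves the necessary room.\<close>
    proof (rule order_tendstoD(2))
      show "(\<lambda>n. \<bar>horo_embedding (g n) x - f0 x\<bar>) \<longlonglongrightarrow> \<bar>h x - f0 x\<bar>"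
        using assms(1) by (intro tendsto_intros) (simp add: horo_limit_iff)
      show "\<bar>h x - f0 x\<bar> < e" using Basis that s by blast
    qed
    then show ?case
      using s by (simp add: eventually_ball_finite)
  qed (auto simp: eventually_conj)
qed

lemma openin_compact_convergence:
  assumes "finite K" "0 < e"
  shows "openin compact_convergence {f. \<forall>x\<in>K. \<bar>f x - f0 x\<bar> < e}"
  unfolding compact_convergence_def openin_topology_generated_by_iff
  by (rule generate_topology_on.Basis) (use assms in blast)

text \<open>Along an enumeration of the group, neighbourhoods controlling ever more points with ever
  smaller error select a convergent sequence. From here on the boundary is a matter of pointwise
  limits.\<close>

lemma mem_closure_iff_horo_limit:
  "h \<in> compact_convergence closure_of range horo_embedding \<longleftrightarrow> (\<exists>g. horo_limit g h)"
proof
  assume h: "h \<in> compact_convergence closure_of range horo_embedding"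
  define e where "e = from_nat_into (UNIV :: lamplighter set)"
  have e: "range e = UNIV"
    unfolding e_def by (rule range_from_nat_into) (use countable_lamplighter in auto)
  have "\<exists>z. \<forall>x\<in>e ` {..n}. \<bar>horo_embedding z x - h x\<bar> < 1 / (real n + 1)" for n
  proof -
    define d where "d = 1 / (real n + 1)"
    define T where "T = {f. \<forall>x\<in>e ` {..n}. \<bar>f x - h x\<bar> < d}"
    have d: "0 < d" by (simp add: d_def)
    have "openin compact_convergence T"
      unfolding T_def by (rule openin_compact_convergence) (use d in simp_all)
    moreover have "h \<in> T" using d by (simp add: T_def)
    ultimately obtain y where "y \<in> range horo_embedding" "y \<in> T"
      using h unfolding in_closure_of by blast
    then show ?thesis unfolding T_def d_def by blast
  qed
  then obtain z where z: "\<And>n x. x \<in> e ` {..n} \<Longrightarrow> \<bar>horo_embedding (z n) x - h x\<bar> < 1 / (real n + 1)"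
    by metis
  have "(\<lambda>n. horo_embedding (z n) x) \<longlonglongrightarrow> h x" for x
  proof (rule Lim_transform_eventually)
    show "(\<lambda>n. h x + (horo_embedding (z n) x - h x)) \<longlonglongrightarrow> h x"
    proof -
      obtain m where "x = e m" using e by (metis rangeE UNIV_I)
      then have "eventually (\<lambda>n. norm (horo_embedding (z n) x - h x) \<le> 1 / (real n + 1)) sequentially"
        using z by (intro eventually_sequentiallyI[of m]) (force simp: less_imp_le)
      moreover have "(\<lambda>n. 1 / (real n + 1)) \<longlonglongrightarrow> 0"
        using LIMSEQ_inverse_real_of_nat by (simp add: inverse_eq_divide add.commute)
      ultimately have "(\<lambda>n. horo_embedding (z n) x - h x) \<longlonglongrightarrow> 0"
        by (rule Lim_null_comparison)
      from tendsto_add[OF tendsto_const[of "h x"] this] show ?thesis by simp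
    qed
  qed simp
  then show "\<exists>g. horo_limit g h" using horo_limit_iff by blast
next
  assume "\<exists>g. horo_limit g h"
  then obtain g where g: "horo_limit g h" ..
  have "topspace compact_convergence = UNIV"
  proof -
    have "openin compact_convergence (UNIV :: (lamplighter \<Rightarrow> real) set)"
      using openin_compact_convergence[of "{}" 1 undefined] by simp
    then show ?thesis using openin_subset by blast
  qed
  moreover have "\<exists>y\<in>range horo_embedding. y \<in> T" if "h \<in> T" "openin compact_convergence T" for T
    using eventually_happens'[OF sequentially_bot horo_limit_openin[OF g that(2,1)]] by blast
  ultimately show "h \<in> compact_convergence closure_of range horo_embedding"
    unfolding in_closure_of by blast
qed

text \<open>The integer-valued form of \<open>horo_embedding\<close>, for which convergence is
  eventual equality.\<close>

definition cocycle :: "lamplighter \<Rightarrow> lamplighter \<Rightarrow> int" where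
  "cocycle z x = travel z x - travel z \<one>\<^bsub>L2\<^esub>"

lemma horo_embedding_eq: "horo_embedding z x = of_int (cocycle z x)"
proof -
  have "real (word_dist z y) = of_int (travel z y)" for y
    by (simp flip: word_dist_eq_travel)
  then show ?thesis by (simp add: horo_embedding_def cocycle_def)
qed

text \<open>Upper end, lower end and height contribute separate differences, so each limit below is
  assembled from independent statements about them.\<close>

lemma cocycle_eq:
  "cocycle z x = 2 * (high z x - high z \<one>\<^bsub>L2\<^esub>) - 2 * (low z x - low z \<one>\<^bsub>L2\<^esub>)
     - \<bar>height z - height x\<bar> + \<bar>height z\<bar>"
  by (simp add: cocycle_def travel_def)

lemma horo_limitI:
  assumes "\<And>x. eventually (\<lambda>n. cocycle (g n) x = F x) sequentially"
  shows "horo_limit g (\<lambda>x. of_int (F x))"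
  unfolding horo_limit_iff
proof
  fix x
  have "eventually (\<lambda>n. of_int (F x) = horo_embedding (g n) x) sequentially"
    using assms[of x] by eventually_elim (simp add: horo_embedding_eq)
  then show "(\<lambda>n. horo_embedding (g n) x) \<longlonglongrightarrow> of_int (F x)"
    by (rule Lim_transform_eventually[OF tendsto_const])
qed

lemma horo_limit_mirror:
  assumes "horo_limit g h"
  shows "horo_limit (mirror \<circ> g) (h \<circ> mirror)"
proof -
  have "horo_embedding (mirror z) x = horo_embedding z (mirror x)" for z x
    using word_dist_mirror[of "mirror z" x] word_dist_mirror[of "mirror z" "\<one>\<^bsub>L2\<^esub>"]
    by (simp add: horo_embedding_def)
  then show ?thesis using assms by (simp add: horo_limit_iff)
qed

section \<open>Limits of the ends\<close>

text \<open>An end far below everything that concerns \<open>x\<close> is produced by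
  \<open>g n\<close> alone, so it is the same whether \<open>g n\<close> is compared with
  \<open>x\<close> or with the identity.\<close>

lemma low_escape:
  assumes "filterlim (\<lambda>n. low (g n) \<one>\<^bsub>L2\<^esub>) at_bot sequentially"
  shows "eventually (\<lambda>n. low (g n) x = low (g n) \<one>\<^bsub>L2\<^esub>) sequentially"
proof -
  \<comment> \<open>Both heights and all lamps of \<open>x\<close> lie at or above this
    position.\<close>
  let ?c = "low x \<one>\<^bsub>L2\<^esub>"
  have c: "?c \<le> height x" "?c \<le> 0" "\<And>i. i \<in> lamps x \<Longrightarrow> ?c \<le> i"
    using low_le(1,2)[of x "\<one>\<^bsub>L2\<^esub>"] low_le(3)[of _ x "\<one>\<^bsub>L2\<^esub>"] by auto
  have *: "low z x = low z \<one>\<^bsub>L2\<^esub>" if "low z \<one>\<^bsub>L2\<^esub> < ?c" for z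
    unfolding low_def
  proof (rule lower_end_cong_below[where c = ?c])
    show "lower_end (diff_lamps z \<one>\<^bsub>L2\<^esub>) (min (height z) (height \<one>\<^bsub>L2\<^esub>)) < ?c"
      using that by (simp add: low_def)
  qed (use c in \<open>force+\<close>)
  have "eventually (\<lambda>n. low (g n) \<one>\<^bsub>L2\<^esub> \<le> ?c - 1) sequentially"
    using assms unfolding filterlim_at_bot by blast
  then show ?thesis by eventually_elim (rule *, simp)
qed

lemma filterlim_uminus_int:
  fixes f :: "'a \<Rightarrow> int"
  shows "filterlim (\<lambda>x. - f x) at_bot F \<longleftrightarrow> filterlim f at_top F"
proof -
  have "(\<forall>Z. eventually (\<lambda>x. - f x \<le> Z) F) \<longleftrightarrow> (\<forall>Z. eventually (\<lambda>x. Z \<le> f x) F)"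
    by (metis (no_types, lifting) eventually_mono minus_le_iff minus_minus)
  then show ?thesis unfolding filterlim_at_bot filterlim_at_top .
qed

lemma high_escape:
  assumes "filterlim (\<lambda>n. high (g n) \<one>\<^bsub>L2\<^esub>) at_top sequentially"
  shows "eventually (\<lambda>n. high (g n) x = high (g n) \<one>\<^bsub>L2\<^esub>) sequentially"
proof -
  have "filterlim (\<lambda>n. low (mirror (g n)) \<one>\<^bsub>L2\<^esub>) at_bot sequentially"
    using assms using filterlim_uminus_int[of "\<lambda>n. high (g n) \<one>\<^bsub>L2\<^esub>"]
    by (simp add: high_eq_low_mirror)
  from low_escape[OF this, of "mirror x"] show ?thesis
    by (simp add: high_eq_low_mirror)
qed

text \<open>Convergence in the product space of configurations; the limit may be infinite although
  every term is finite.\<close>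

definition lamps_converge :: "(nat \<Rightarrow> lamplighter) \<Rightarrow> int set \<Rightarrow> bool" where
  "lamps_converge g L \<longleftrightarrow> (\<forall>i. eventually (\<lambda>n. i \<in> lamps (g n) \<longleftrightarrow> i \<in> L) sequentially)"

lemma lamps_converge_bdd_below:
  assumes "lamps_converge g L" "\<And>n i. i \<in> lamps (g n) \<Longrightarrow> b \<le> i" "i \<in> L"
  shows "b \<le> i"
proof -
  have "eventually (\<lambda>n. i \<in> lamps (g n)) sequentially"
    using assms(1,3) unfolding lamps_converge_def by (auto elim: eventually_mono)
  then show ?thesis using assms(2) eventually_happens'[OF sequentially_bot] by blast
qed

text \<open>The end is capped by \<open>k\<close> and the sequence has no lamps below
  \<open>b\<close>, so only the finitely many positions from \<open>b\<close> to \<open>k\<close>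
  have to settle.\<close>

lemma low_converge:
  assumes L: "lamps_converge g L" and b: "\<And>n i. i \<in> lamps (g n) \<Longrightarrow> b \<le> i"
    and k: "eventually (\<lambda>n. min (height (g n)) (height x) = k) sequentially"
  shows "eventually (\<lambda>n. low (g n) x = lower_end (sym_diff L (lamps x)) k) sequentially"
proof -
  have L': "bdd_below L" using lamps_converge_bdd_below[OF L, of b] b by (intro bdd_belowI[of _ b]) auto
  then have bdd: "bdd_below (sym_diff L (lamps x))"
    by (metis bdd_below_Un bdd_below_mono Diff_subset finite_bdd(1) finite_lamps)
  have "eventually (\<lambda>n. \<forall>i\<in>{b..k}. i \<in> lamps (g n) \<longleftrightarrow> i \<in> L) sequentially"
    using L by (intro eventually_ball_finite) (auto simp: lamps_converge_def)
  then show ?thesis using k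
  proof eventually_elim
    case (elim n)
    have *: "i \<in> lamps (g n) \<longleftrightarrow> i \<in> L" if "i < k + 1" for i
    proof (cases "b \<le> i")
      case False
      then show ?thesis using b lamps_converge_bdd_below[OF L, of b] by blast
    qed (use elim that in auto)
    \<comment> \<open>The cut is at \<open>k + 1\<close> because the end may be \<open>k\<close>
      itself.\<close>
    have "lower_end (sym_diff L (lamps x)) k < k + 1"
      using lower_end_le[OF bdd, of k] by simp
    from lower_end_cong_below[OF bdd _ _ _ this, of "diff_lamps (g n) x" k] show ?case
      using * elim(2) by (auto simp: low_def)
  qed
qed

section \<open>Integer form of the extended-real formulas\<close>

lemma lower_end_ereal:
  assumes "bdd_below A"
  shows "min (lowest A) (ereal (of_int k)) = ereal (of_int (lower_end A k))"
proof (rule antisym)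
  show "min (lowest A) (ereal (of_int k)) \<le> ereal (of_int (lower_end A k))"
    using lower_end_attained[OF assms, of k]
  proof
    assume "lower_end A k \<in> A"
    then show ?thesis unfolding lowest_def by (intro min.coboundedI1 INF_lower2[of "lower_end A k"]) auto
  qed simp
  show "ereal (of_int (lower_end A k)) \<le> min (lowest A) (ereal (of_int k))"
    unfolding lowest_def using lower_end_le[OF assms] lower_end_le_mem[OF assms]
    by (intro min.boundedI INF_greatest) auto
qed

text \<open>Members at or above \<open>k\<close> cannot beat the reference point. For ribs this
  permits replacing the limit configuration by a finite part of it.\<close>

lemma lower_end_cong:
  assumes "bdd_below A" "bdd_below B" "\<And>i. i < k \<Longrightarrow> i \<in> A \<longleftrightarrow> i \<in> B"
  shows "lower_end A k = lower_end B k"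
proof -
  have *: "lower_end A k \<le> lower_end B k"
    if "bdd_below A" "bdd_below B" "\<And>i. i < k \<Longrightarrow> i \<in> A \<longleftrightarrow> i \<in> B" for A B
  proof -
    have "lower_end A k \<le> i" if "i \<in> B" for i
      using \<open>\<And>i. i < k \<Longrightarrow> i \<in> A \<longleftrightarrow> i \<in> B\<close>[of i] that lower_end_le[OF \<open>bdd_below A\<close>, of k]
        lower_end_le_mem[OF \<open>bdd_below A\<close>, of i k] by (cases "i < k") auto
    then show ?thesis
      using that lower_end_le by (simp add: le_lower_end_iff)
  qed
  show ?thesis using *[of A B] *[of B A] assms by force
qed

lemma upper_end_ereal:
  assumes "bdd_above A"
  shows "max (highest A + 1) (ereal (of_int k)) = ereal (of_int (upper_end A k))"
proof (cases "A = {}")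
  case True
  then show ?thesis by (simp add: highest_empty)
next
  case False
  then obtain j where j: "j \<in> A" by blast
  \<comment> \<open>The member \<open>j\<close> by itself already produces the end
    \<open>j + 1\<close>, so with this reference point the end comes from a member and
    \<open>m\<close> is the maximum of \<open>A\<close>.\<close>
  define m where "m = upper_end A (j + 1) - 1"
  have A': "bdd_below (reflect A)" using assms by simp
  have "lower_end (reflect A) (- (j + 1)) \<in> reflect A"
    using lower_end_attained[OF A', of "- (j + 1)"] j by auto
  then have "- 1 - lower_end (reflect A) (- (j + 1)) \<in> A" by (simp only: mem_reflect)
  also have "- 1 - lower_end (reflect A) (- (j + 1)) = m" by (simp add: m_def upper_end_def)
  finally have m: "m \<in> A" .
  have le: "i \<le> m" if "i \<in> A" for i
    using upper_end_gt_mem[OF assms that, of "j + 1"] by (simp add: m_def)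
  have "highest A = ereal (of_int m)" using highest_eq[OF m le] .
  moreover have "upper_end A k = max (m + 1) k"
  proof (rule antisym)
    show "upper_end A k \<le> max (m + 1) k"
      by (auto simp: upper_end_le_iff[OF assms] max_def dest!: le)
    show "max (m + 1) k \<le> upper_end A k"
      using upper_end_ge[OF assms, of k] upper_end_gt_mem[OF assms m, of k] by simp
  qed
  ultimately show ?thesis by (simp add: max_def one_ereal_def)
qed

lemma bdd_below_sym_diff:
  "bdd_below (sym_diff A (lamps x)) \<longleftrightarrow> bdd_below A"
proof
  assume "bdd_below (sym_diff A (lamps x))"
  moreover have "A \<subseteq> sym_diff A (lamps x) \<union> lamps x" by blast
  ultimately show "bdd_below A"
    by (meson bdd_below_Un bdd_below_mono finite_bdd(1) finite_lamps)
next
  assume "bdd_below A"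
  then show "bdd_below (sym_diff A (lamps x))"
    by (metis bdd_below_Un bdd_below_mono Diff_subset finite_bdd(1) finite_lamps)
qed

lemma bdd_above_sym_diff:
  "bdd_above (sym_diff A (lamps x)) \<longleftrightarrow> bdd_above A"
proof -
  have "bdd_above (sym_diff A (lamps x)) \<longleftrightarrow> bdd_below (sym_diff (reflect A) (lamps (mirror x)))"
    by (simp flip: reflect_sym_diff)
  then show ?thesis by (simp only: bdd_below_sym_diff bdd_below_reflect)
qed

text \<open>\<open>b_up\<close> uses its ray only through the limit configuration; limits of
  arbitrary sequences provide such a set without a ray.\<close>

definition busemann_up :: "int set \<Rightarrow> lamplighter \<Rightarrow> int" where
  "busemann_up L x = 2 * (lower_end L 0 - lower_end (sym_diff L (lamps x)) (height x)) + height x"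

lemma b_up_eq:
  assumes "bdd_below (ray_lamps \<gamma>)"
  shows "b_up \<gamma> = (\<lambda>x. of_int (busemann_up (ray_lamps \<gamma>) x))"
proof
  fix x
  have "bdd_below (sym_diff (ray_lamps \<gamma>) (lamps x))" using assms by (rule iffD2[OF bdd_below_sym_diff])
  from lower_end_ereal[OF this, of "height x"] lower_end_ereal[OF assms, of 0]
  show "b_up \<gamma> x = of_int (busemann_up (ray_lamps \<gamma>) x)"
    by (simp add: b_up_def busemann_up_def zero_ereal_def)
qed

lemma b_down_eq:
  assumes "bdd_above (ray_lamps \<gamma>)"
  shows "b_down \<gamma> = (\<lambda>x. of_int (busemann_up (reflect (ray_lamps \<gamma>)) (mirror x)))"
proof
  fix x
  have "bdd_above (sym_diff (ray_lamps \<gamma>) (lamps x))" using assms by (rule iffD2[OF bdd_above_sym_diff])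
  from upper_end_ereal[OF this, of "height x"] upper_end_ereal[OF assms, of 0]
  show "b_down \<gamma> x = of_int (busemann_up (reflect (ray_lamps \<gamma>)) (mirror x))"
    by (simp add: b_down_def busemann_up_def zero_ereal_def upper_end_def flip: reflect_sym_diff)
qed

lemma rib_up_eq:
  "rib_up f x = of_int (2 * (lower_end (lamps f) (min (height f) 0)
       - lower_end (diff_lamps f x) (min (height f) (height x))) + \<bar>height f\<bar> - \<bar>height f - height x\<bar>)"
proof -
  have "min (ereal (of_int (height f))) 0 = ereal (of_int (min (height f) 0))"
    "min (ereal (of_int (height x))) (ereal (of_int (height f))) = ereal (of_int (min (height f) (height x)))"
    by (simp_all add: min_def zero_ereal_def)
  then show ?thesis
    using lower_end_ereal[of "lamps f" "min (height f) 0"]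
      lower_end_ereal[of "diff_lamps f x" "min (height f) (height x)"]
    by (simp add: rib_up_def spine_def)
qed

text \<open>The shift in M + 1 is absorbed by \<open>reflect\<close>, which maps lamps as
  edges.\<close>

lemma rib_down_eq: "rib_down f x = rib_up (mirror f) (mirror x)"
proof -
  have "max (ereal (of_int (height f))) 0 = ereal (of_int (max (height f) 0))"
    "max (ereal (of_int (height x))) (ereal (of_int (height f))) = ereal (of_int (max (height x) (height f)))"
    by (simp_all add: max_def zero_ereal_def)
  then have 1: "rib_down f x = of_int (2 * (upper_end (diff_lamps f x) (max (height x) (height f))
      - upper_end (lamps f) (max (height f) 0)) + \<bar>height f\<bar> - \<bar>height f - height x\<bar>)"
    using upper_end_ereal[of "lamps f" "max (height f) 0"]
      upper_end_ereal[of "diff_lamps f x" "max (height x) (height f)"]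
    by (simp add: rib_down_def spine_def)
  have "- max (height x) (height f) = min (- height f) (- height x)"
    "- max (height f) 0 = min (- height f) 0" by simp_all
  then have 2: "lower_end (diff_lamps (mirror f) (mirror x)) (min (- height f) (- height x))
        = - upper_end (diff_lamps f x) (max (height x) (height f))"
      "lower_end (lamps (mirror f)) (min (- height f) 0) = - upper_end (lamps f) (max (height f) 0)"
    unfolding upper_end_def reflect_sym_diff lamps_mirror by simp_all
  have 3: "\<bar>- height f - - height x\<bar> = \<bar>height f - height x\<bar>" by simp
  have 4: "2 * (- b - - a) = 2 * (a - b)" for a b :: int by simp
  show ?thesis
    unfolding 1 rib_up_eq height_mirror 2 3 4 abs_minus_cancel by (rule refl)
qed

lemma highest_less_iff: "highest (lamps f) < ereal (of_int k) \<longleftrightarrow> (\<forall>i\<in>lamps f. i < k)"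
proof (cases "lamps f = {}")
  case False
  then have "highest (lamps f) = ereal (of_int (Max (lamps f)))"
    by (intro highest_eq) auto
  then show ?thesis using False by simp
qed (simp add: highest_empty)

lemma lowest_ge_iff: "ereal (of_int k) \<le> lowest A \<longleftrightarrow> (\<forall>i\<in>A. k \<le> i)"
  by (simp add: lowest_def le_INF_iff)

section \<open>Limits of the families\<close>

lemma horo_limit_spine:
  assumes "eventually (\<lambda>n. height (g n) = l) sequentially"
    and "filterlim (\<lambda>n. low (g n) \<one>\<^bsub>L2\<^esub>) at_bot sequentially"
    and "filterlim (\<lambda>n. high (g n) \<one>\<^bsub>L2\<^esub>) at_top sequentially"
  shows "horo_limit g (spine l)"
  unfolding spine_def
proof (rule horo_limitI)
  fix x
  show "eventually (\<lambda>n. cocycle (g n) x = \<bar>l\<bar> - \<bar>l - height x\<bar>) sequentially"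
    using assms(1) low_escape[OF assms(2), of x] high_escape[OF assms(3), of x]
    by eventually_elim (simp add: cocycle_eq)
qed

text \<open>The lower end is capped by \<open>l\<close> and the upper end cancels, so the limit sees
  \<open>L\<close> only below \<open>l\<close>. Hence a finite \<open>f\<close> can stand for an
  infinite \<open>L\<close>.\<close>

lemma horo_limit_rib_up:
  assumes l: "eventually (\<lambda>n. height (g n) = l) sequentially"
    and L: "lamps_converge g L" and b: "\<And>n i. i \<in> lamps (g n) \<Longrightarrow> b \<le> i"
    and "filterlim (\<lambda>n. high (g n) \<one>\<^bsub>L2\<^esub>) at_top sequentially"
    and f: "height f = l" "\<And>i. i < l \<Longrightarrow> i \<in> lamps f \<longleftrightarrow> i \<in> L"
  shows "horo_limit g (rib_up f)"
  unfolding rib_up_eq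
proof (rule horo_limitI)
  fix x
  have L': "bdd_below L" using lamps_converge_bdd_below[OF L, of b] b by (intro bdd_belowI[of _ b]) auto
  have low: "eventually (\<lambda>n. low (g n) y = lower_end (diff_lamps f y) (min l (height y))) sequentially" for y
  proof -
    have "eventually (\<lambda>n. min (height (g n)) (height y) = min l (height y)) sequentially"
      using l by eventually_elim simp
    moreover have "lower_end (sym_diff L (lamps y)) (min l (height y)) = lower_end (diff_lamps f y) (min l (height y))"
      using L' f(2) by (intro lower_end_cong iffD2[OF bdd_below_sym_diff]) auto
    moreover have "eventually (\<lambda>n. low (g n) y = lower_end (sym_diff L (lamps y)) (min l (height y))) sequentially"
      by (rule low_converge[OF L b]) (use calculation(1) in auto)
    ultimately show ?thesis by simp
  qed
  show "eventually (\<lambda>n. cocycle (g n) x = 2 * (lower_end (lamps f) (min (height f) 0)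
       - lower_end (diff_lamps f x) (min (height f) (height x))) + \<bar>height f\<bar> - \<bar>height f - height x\<bar>) sequentially"
    using l low[of x] low[of "\<one>\<^bsub>L2\<^esub>"] high_escape[OF assms(4), of x]
    by eventually_elim (simp add: cocycle_eq f(1))
qed

lemma filterlim_high:
  assumes "filterlim (\<lambda>n. height (g n)) at_top sequentially"
  shows "filterlim (\<lambda>n. high (g n) x) at_top sequentially"
  by (rule filterlim_at_top_mono[OF assms]) (simp add: high_ge)

lemma eventually_abs_diff:
  assumes "filterlim (\<lambda>n. height (g n)) at_top sequentially"
  shows "eventually (\<lambda>n. \<bar>height (g n)\<bar> - \<bar>height (g n) - k\<bar> = k) sequentially"
proof -
  have "eventually (\<lambda>n. \<bar>k\<bar> \<le> height (g n)) sequentially"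
    using assms unfolding filterlim_at_top by blast
  then show ?thesis by eventually_elim linarith
qed

lemma horo_limit_height:
  assumes "filterlim (\<lambda>n. height (g n)) at_top sequentially"
    and "filterlim (\<lambda>n. low (g n) \<one>\<^bsub>L2\<^esub>) at_bot sequentially"
  shows "horo_limit g (\<lambda>x. of_int (height x))"
proof (rule horo_limitI)
  fix x
  show "eventually (\<lambda>n. cocycle (g n) x = height x) sequentially"
    using eventually_abs_diff[OF assms(1), of "height x"] low_escape[OF assms(2), of x]
      high_escape[OF filterlim_high[OF assms(1)], of x]
    by eventually_elim (simp add: cocycle_eq)
qed

text \<open>Once the lamplighter is above \<open>height y\<close>, the cap on the lower end is
  \<open>height y\<close> itself. It is arbitrary as \<open>y\<close> varies, so, unlike a rib, the
  limit remembers all of \<open>L\<close>.\<close>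

lemma horo_limit_busemann_up:
  assumes g: "filterlim (\<lambda>n. height (g n)) at_top sequentially"
    and L: "lamps_converge g L" and b: "\<And>n i. i \<in> lamps (g n) \<Longrightarrow> b \<le> i"
  shows "horo_limit g (\<lambda>x. of_int (busemann_up L x))"
proof (rule horo_limitI)
  fix x
  have low: "eventually (\<lambda>n. low (g n) y = lower_end (sym_diff L (lamps y)) (height y)) sequentially" for y
  proof (rule low_converge[OF L b])
    have "eventually (\<lambda>n. height y \<le> height (g n)) sequentially"
      using g unfolding filterlim_at_top by blast
    then show "eventually (\<lambda>n. min (height (g n)) (height y) = height y) sequentially"
      by eventually_elim simp
  qed
  show "eventually (\<lambda>n. cocycle (g n) x = busemann_up L x) sequentially"
    using eventually_abs_diff[OF g, of "height x"] low[of x] low[of "\<one>\<^bsub>L2\<^esub>"]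
      high_escape[OF filterlim_high[OF g], of x]
    by eventually_elim (simp add: cocycle_eq busemann_up_def)
qed

section \<open>Extraction of subsequences\<close>

lemma incseq_int_cases:
  fixes f :: "nat \<Rightarrow> int"
  assumes "incseq f"
  shows "(\<exists>c N. \<forall>n\<ge>N. f n = c) \<or> filterlim f at_top sequentially"
proof (cases "bdd_above (range f)")
  case True
  then obtain M where M: "\<And>n. f n \<le> M" by (auto simp: bdd_above_def)
  have "\<exists>N. \<forall>n. f n \<le> f N"
  proof -
    have "f 0 \<le> f n" for n using assms by (simp add: incseq_def)
    then have "finite (range f)"
      using M by (intro finite_subset[of "range f" "{f 0..M}"]) auto
    then have "Max (range f) \<in> range f" "\<And>n. f n \<le> Max (range f)" by (auto intro: Max_in)
    then show ?thesis by (metis imageE)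
  qed
  then show ?thesis using assms by (meson incseq_def order_antisym)
next
  case False
  have "eventually (\<lambda>n. Z \<le> f n) sequentially" for Z
  proof -
    obtain N where "Z < f N"
      using False by (metis bdd_above.I2 linorder_not_less UNIV_I)
    then show ?thesis
      using assms by (intro eventually_sequentiallyI[of N]) (meson incseq_def less_imp_le order_trans)
  qed
  then show ?thesis unfolding filterlim_at_top by blast
qed

text \<open>A monotone subsequence of integers is eventually constant or tends to infinity in its
  direction; dropping an initial segment makes the constant case hold at every index.\<close>

lemma int_subseq:
  fixes f :: "nat \<Rightarrow> int"
  obtains r c where "strict_mono r" "\<And>n :: nat. f (r n) = c"
    | r :: "nat \<Rightarrow> nat" where "strict_mono r" "filterlim (\<lambda>n. f (r n)) at_top sequentially"
    | r :: "nat \<Rightarrow> nat" where "strict_mono r" "filterlim (\<lambda>n. f (r n)) at_bot sequentially"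
proof -
  note const_case = that(1) and top_case = that(2) and bot_case = that(3)
  obtain r where r: "strict_mono r" "monoseq (\<lambda>n. f (r n))"
    using seq_monosub by blast
  have const: thesis if "\<And>n. n \<ge> N \<Longrightarrow> f (r n) = c" for N c
    by (rule const_case[of "\<lambda>n. r (n + N)" c]) (use r that in \<open>auto simp: strict_mono_def\<close>)
  have "incseq (\<lambda>n. f (r n)) \<or> incseq (\<lambda>n. - f (r n))"
    using r(2) by (simp add: monoseq_def incseq_def)
  then consider "incseq (\<lambda>n. f (r n))" | "incseq (\<lambda>n. - f (r n))"
    by blast
  then show thesis
  proof cases
    case 1
    from incseq_int_cases[OF this] show thesis
      using const r(1) top_case by blast
  next
    case 2
    from incseq_int_cases[OF this] show thesis
    proof
      assume "\<exists>c N. \<forall>n\<ge>N. - f (r n) = c"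
      then obtain c N where "\<forall>n\<ge>N. - f (r n) = c" by blast
      then show thesis using const[of N "- c"] by (metis minus_minus)
    next
      assume "filterlim (\<lambda>n. - f (r n)) at_top sequentially"
      then have "filterlim (\<lambda>n. f (r n)) at_bot sequentially"
        using filterlim_uminus_int[of "\<lambda>n. - f (r n)"] by simp
      then show thesis using r(1) bot_case by blast
    qed
  qed
qed

text \<open>Tychonoff for copies of {0, 1}: with countably many coordinates compactness is
  sequential, and a convergent sequence of zeros and ones is eventually constant.\<close>

lemma lamps_converge_subseq:
  obtains r L where "strict_mono (r :: nat \<Rightarrow> nat)" "lamps_converge (g \<circ> r) L"
proof -
  let ?P = "PiE UNIV (\<lambda>_ :: int. {0, 1 :: real})"
  have "compactin (product_topology (\<lambda>_. euclidean) UNIV) ?P"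
    by (simp add: compactin_PiE)
  then have "seq_compact ?P"
    by (simp add: euclidean_product_topology compact_imp_seq_compact)
  moreover have "\<forall>n. (indicator (lamps (g n)) :: int \<Rightarrow> real) \<in> ?P"
    by (simp add: PiE_UNIV_domain indicator_def)
  ultimately obtain l r where lr: "l \<in> ?P" "strict_mono r"
      "((\<lambda>n. indicator (lamps (g n)) :: int \<Rightarrow> real) \<circ> r) \<longlonglongrightarrow> l"
    by (rule seq_compactE)
  have "eventually (\<lambda>n. i \<in> lamps (g (r n)) \<longleftrightarrow> i \<in> {i. l i = 1}) sequentially" for i
  proof -
    have "(\<lambda>n. indicator (lamps (g (r n))) i :: real) \<longlonglongrightarrow> l i"
      using continuous_on_tendsto_compose[OF continuous_on_product_coordinates[of i] lr(3)]
      by (simp add: o_def)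
    then have "eventually (\<lambda>n. dist (indicator (lamps (g (r n))) i :: real) (l i) < 1) sequentially"
      by (rule tendstoD) simp
    moreover have "l i = 0 \<or> l i = 1" using lr(1) by (auto simp: PiE_iff)
    ultimately show ?thesis
      by (auto elim!: eventually_mono simp: indicator_def dist_real_def split: if_splits)
  qed
  then show thesis using that[of r "{i. l i = 1}"] lr(2) by (simp add: lamps_converge_def)
qed

section \<open>Classification of the limits\<close>

lemma filterlim_subseq_compose:
  "filterlim f F sequentially \<Longrightarrow> strict_mono r \<Longrightarrow> filterlim (\<lambda>n. f (r n)) F sequentially"
  using filterlim_compose[of f F sequentially r] filterlim_subseq by blast

lemma lamps_ge_low: "i \<in> lamps z \<Longrightarrow> low z \<one>\<^bsub>L2\<^esub> \<le> i"
  using low_le(3)[of i z "\<one>\<^bsub>L2\<^esub>"] by simp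

lemma lamps_less_high: "i \<in> lamps z \<Longrightarrow> i < high z \<one>\<^bsub>L2\<^esub>"
  using high_ge(3)[of i z "\<one>\<^bsub>L2\<^esub>"] by simp

lemma horo_limit_cases_at_top:
  assumes h: "horo_limit g h" and top: "filterlim (\<lambda>n. height (g n)) at_top sequentially"
  shows "h = (\<lambda>x. of_int (height x)) \<or> (\<exists>L. bdd_below L \<and> h = (\<lambda>x. of_int (busemann_up L x)))"
proof (cases rule: int_subseq[of "\<lambda>n. low (g n) \<one>\<^bsub>L2\<^esub>"])
  case (1 r c)
  obtain s L where s: "strict_mono s" and L: "lamps_converge (g \<circ> r \<circ> s) L"
    using lamps_converge_subseq by blast
  let ?g = "g \<circ> r \<circ> s"
  have b: "c \<le> i" if "i \<in> lamps (?g n)" for n i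
    using lamps_ge_low[OF that] 1(2)[of "s n"] by simp
  have "horo_limit ?g (\<lambda>x. of_int (busemann_up L x))"
  proof (rule horo_limit_busemann_up)
    show "filterlim (\<lambda>n. height (?g n)) at_top sequentially"
      using filterlim_subseq_compose[OF filterlim_subseq_compose[OF top 1(1)] s] by simp
    show "lamps_converge ?g L" by (rule L)
    show "i \<in> lamps (?g n) \<Longrightarrow> c \<le> i" for n i by (rule b)
  qed
  moreover have "horo_limit ?g h"
    by (rule horo_limit_subseq[OF horo_limit_subseq[OF h 1(1)] s])
  moreover have "bdd_below L"
    using lamps_converge_bdd_below[OF L, of c] b by (intro bdd_belowI[of _ c]) blast
  ultimately have "h = (\<lambda>x. of_int (busemann_up L x))" "bdd_below L"
    using horo_limit_unique by metis+
  then show ?thesis by blast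
next
  case (2 r)
  \<comment> \<open>Impossible: the identity stands at 0, so the lower end is never
    positive.\<close>
  have "eventually (\<lambda>n. 1 \<le> low (g (r n)) \<one>\<^bsub>L2\<^esub>) sequentially"
    using 2(2) unfolding filterlim_at_top by blast
  then have "\<exists>n. 1 \<le> low (g (r n)) \<one>\<^bsub>L2\<^esub>"
    using eventually_happens'[OF sequentially_bot] by blast
  then obtain n where "1 \<le> low (g (r n)) \<one>\<^bsub>L2\<^esub>" ..
  with low_le(2)[of "g (r n)" "\<one>\<^bsub>L2\<^esub>"] show ?thesis by simp
next
  case (3 r)
  have "horo_limit (g \<circ> r) (\<lambda>x. of_int (height x))"
    by (rule horo_limit_height) (use filterlim_subseq_compose[OF top 3(1)] 3(2) in simp_all)
  from horo_limit_unique[OF horo_limit_subseq[OF h 3(1)] this] show ?thesis by simp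
qed

lemma horo_limit_case_rib_up:
  assumes h: "horo_limit g h" and l: "\<And>n. height (g n) = l"
    and c: "\<And>n. low (g n) \<one>\<^bsub>L2\<^esub> = c"
    and top: "filterlim (\<lambda>n. high (g n) \<one>\<^bsub>L2\<^esub>) at_top sequentially"
  shows "\<exists>f. height f = l \<and> (\<forall>i\<in>lamps f. i < l) \<and> h = rib_up f"
proof -
  obtain s L where s: "strict_mono s" and L: "lamps_converge (g \<circ> s) L"
    using lamps_converge_subseq by blast
  have b: "c \<le> i" if "i \<in> lamps ((g \<circ> s) n)" for n i
    using lamps_ge_low[OF that] c by simp
  \<comment> \<open>Cutting \<open>L\<close> at \<open>l\<close> removes what the limit does not
    see; the rest is finite and has the normal form M(f) < H(f).\<close>
  have "L \<inter> {..<l} \<subseteq> {c..<l}"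
    using lamps_converge_bdd_below[OF L, of c] b by force
  then have fin: "finite (L \<inter> {..<l})" by (rule finite_subset) simp
  let ?f = "lamp_stand (L \<inter> {..<l}) l"
  have "horo_limit (g \<circ> s) (rib_up ?f)"
  proof (rule horo_limit_rib_up[where l = l])
    show "lamps_converge (g \<circ> s) L" by (rule L)
    show "i \<in> lamps ((g \<circ> s) n) \<Longrightarrow> c \<le> i" for n i by (rule b)
    show "filterlim (\<lambda>n. high ((g \<circ> s) n) \<one>\<^bsub>L2\<^esub>) at_top sequentially"
      using filterlim_subseq_compose[OF top s] by simp
  qed (use fin l in simp_all)
  then have "h = rib_up ?f"
    using horo_limit_unique horo_limit_subseq[OF h s] by blast
  then show ?thesis using fin by (intro exI[of _ ?f]) auto
qed

text \<open>With height and both ends fixed only finitely many lamp stands are possible, so a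
  subsequence is eventually constant.\<close>

lemma horo_limit_case_finite:
  assumes h: "horo_limit g h" and l: "\<And>n. height (g n) = l"
    and c: "\<And>n. low (g n) \<one>\<^bsub>L2\<^esub> = c" and d: "\<And>n. high (g n) \<one>\<^bsub>L2\<^esub> = d"
  shows "h \<in> range horo_embedding"
proof -
  obtain s L where s: "strict_mono s" and L: "lamps_converge (g \<circ> s) L"
    using lamps_converge_subseq by blast
  define f where "f = lamp_stand (L \<inter> {c..<d}) l"
  have "eventually (\<lambda>n. \<forall>i\<in>{c..<d}. i \<in> lamps (g (s n)) \<longleftrightarrow> i \<in> L) sequentially"
    using L by (intro eventually_ball_finite) (auto simp: lamps_converge_def)
  then have ev: "eventually (\<lambda>n. g (s n) = f) sequentially"
  proof eventually_elim
    case (elim n)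
    have "i \<in> {c..<d}" if "i \<in> lamps (g (s n))" for i
      using lamps_ge_low[OF that] lamps_less_high[OF that] c d by simp
    then have "lamps (g (s n)) = L \<inter> {c..<d}"
      using elim by blast
    then show ?case
      using l by (simp add: f_def lamplighter_eq_iff)
  qed
  have "horo_limit (g \<circ> s) (horo_embedding f)"
    unfolding horo_limit_iff
  proof
    fix x
    from ev have "eventually (\<lambda>n. horo_embedding f x = horo_embedding ((g \<circ> s) n) x) sequentially"
      by eventually_elim simp
    then show "(\<lambda>n. horo_embedding ((g \<circ> s) n) x) \<longlonglongrightarrow> horo_embedding f x"
      by (rule Lim_transform_eventually[OF tendsto_const])
  qed
  then show ?thesis
    using horo_limit_unique horo_limit_subseq[OF h s] by blast
qed

lemma horo_limit_cases_const:
  assumes h: "horo_limit g h" and l: "\<And>n. height (g n) = l"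
  shows "h = spine l \<or> (\<exists>f. height f = l \<and> (\<forall>i\<in>lamps f. i < l) \<and> h = rib_up f)
     \<or> (\<exists>f. height f = l \<and> (\<forall>i\<in>lamps f. l \<le> i) \<and> h = rib_down f) \<or> h \<in> range horo_embedding"
proof -
  have low0: "low z \<one>\<^bsub>L2\<^esub> \<le> 0" for z using low_le(2)[of z "\<one>\<^bsub>L2\<^esub>"] by simp
  have high0: "0 \<le> high z \<one>\<^bsub>L2\<^esub>" for z using high_ge(2)[of "\<one>\<^bsub>L2\<^esub>" z] by simp
  obtain r where r: "strict_mono r" and r': "(\<exists>c. \<forall>n. low (g (r n)) \<one>\<^bsub>L2\<^esub> = c) \<or>
     filterlim (\<lambda>n. low (g (r n)) \<one>\<^bsub>L2\<^esub>) at_bot sequentially"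
  proof (cases rule: int_subseq[of "\<lambda>n. low (g n) \<one>\<^bsub>L2\<^esub>"])
    case (2 r)
    have "eventually (\<lambda>n. 1 \<le> low (g (r n)) \<one>\<^bsub>L2\<^esub>) sequentially"
      using 2(2) unfolding filterlim_at_top by blast
    then have "\<exists>n. 1 \<le> low (g (r n)) \<one>\<^bsub>L2\<^esub>"
      using eventually_happens'[OF sequentially_bot] by blast
    then obtain n where "1 \<le> low (g (r n)) \<one>\<^bsub>L2\<^esub>" ..
    with low0[of "g (r n)"] have False by simp
    then show ?thesis ..
  qed (use that in blast)+
  obtain s where s: "strict_mono s" and s': "(\<exists>d. \<forall>n. high (g (r (s n))) \<one>\<^bsub>L2\<^esub> = d) \<or>
     filterlim (\<lambda>n. high (g (r (s n))) \<one>\<^bsub>L2\<^esub>) at_top sequentially"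
  proof (cases rule: int_subseq[of "\<lambda>n. high (g (r n)) \<one>\<^bsub>L2\<^esub>"])
    case (3 s)
    have "eventually (\<lambda>n. high (g (r (s n))) \<one>\<^bsub>L2\<^esub> \<le> - 1) sequentially"
      using 3(2) unfolding filterlim_at_bot by blast
    then have "\<exists>n. high (g (r (s n))) \<one>\<^bsub>L2\<^esub> \<le> - 1"
      using eventually_happens'[OF sequentially_bot] by blast
    then obtain n where "high (g (r (s n))) \<one>\<^bsub>L2\<^esub> \<le> - 1" ..
    with high0[of "g (r (s n))"] have False by simp
    then show ?thesis ..
  qed (use that in blast)+
  define k where "k = g \<circ> r \<circ> s"
  have k: "horo_limit k h" unfolding k_def by (rule horo_limit_subseq[OF horo_limit_subseq[OF h r] s])
  have kl: "height (k n) = l" for n using l by (simp add: k_def)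
  have low: "(\<exists>c. \<forall>n. low (k n) \<one>\<^bsub>L2\<^esub> = c) \<or> filterlim (\<lambda>n. low (k n) \<one>\<^bsub>L2\<^esub>) at_bot sequentially"
    using r' filterlim_subseq_compose[OF _ s, of "\<lambda>n. low (g (r n)) \<one>\<^bsub>L2\<^esub>" at_bot]
    unfolding k_def o_def by blast
  have high: "(\<exists>c. \<forall>n. high (k n) \<one>\<^bsub>L2\<^esub> = c) \<or> filterlim (\<lambda>n. high (k n) \<one>\<^bsub>L2\<^esub>) at_top sequentially"
    using s' unfolding k_def o_def .
  from low show ?thesis
  proof
    assume "\<exists>c. \<forall>n. low (k n) \<one>\<^bsub>L2\<^esub> = c"
    then obtain c where c: "\<And>n. low (k n) \<one>\<^bsub>L2\<^esub> = c" by blast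
    show ?thesis
      using high horo_limit_case_rib_up[OF k kl c] horo_limit_case_finite[OF k kl c] by blast
  next
    assume bot: "filterlim (\<lambda>n. low (k n) \<one>\<^bsub>L2\<^esub>) at_bot sequentially"
    from high show ?thesis
    proof
      assume "\<exists>c. \<forall>n. high (k n) \<one>\<^bsub>L2\<^esub> = c"
      then obtain c where c: "\<And>n. high (k n) \<one>\<^bsub>L2\<^esub> = c" by blast
      \<comment> \<open>The descending rib is obtained in the mirror; i to -1 - i turns the strict
        bound \<open>< - l\<close> into the weak bound \<open>\<ge> l\<close>.\<close>
      have "\<exists>f. height f = - l \<and> (\<forall>i\<in>lamps f. i < - l) \<and> h \<circ> mirror = rib_up f"
      proof (rule horo_limit_case_rib_up)
        show "horo_limit (mirror \<circ> k) (h \<circ> mirror)" using k by (rule horo_limit_mirror)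
        show "height ((mirror \<circ> k) n) = - l" for n using kl by simp
        show "low ((mirror \<circ> k) n) \<one>\<^bsub>L2\<^esub> = - c" for n
          using high_eq_low_mirror[of "k n" "\<one>\<^bsub>L2\<^esub>"] c[of n] by simp
        have "filterlim (\<lambda>n. - low (k n) \<one>\<^bsub>L2\<^esub>) at_top sequentially"
          using bot filterlim_uminus_int[of "\<lambda>n. - low (k n) \<one>\<^bsub>L2\<^esub>"] by simp
        then show "filterlim (\<lambda>n. high ((mirror \<circ> k) n) \<one>\<^bsub>L2\<^esub>) at_top sequentially"
          using high_mirror[of _ "\<one>\<^bsub>L2\<^esub>"] by simp
      qed
      then obtain f where f: "height f = - l" "\<And>i. i \<in> lamps f \<Longrightarrow> i < - l" "h \<circ> mirror = rib_up f"
        by blast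
      have "h x = rib_down (mirror f) x" for x
        using fun_cong[OF f(3), of "mirror x"] by (simp add: rib_down_eq)
      moreover have "l \<le> i" if "i \<in> lamps (mirror f)" for i
        using f(2)[of "- 1 - i"] that by simp
      ultimately show ?thesis
        using f(1) by (intro disjI2 disjI1 exI[of _ "mirror f"]) auto
    next
      assume "filterlim (\<lambda>n. high (k n) \<one>\<^bsub>L2\<^esub>) at_top sequentially"
      then have "horo_limit k (spine l)"
        using kl bot by (intro horo_limit_spine) simp_all
      then show ?thesis using horo_limit_unique k by blast
    qed
  qed
qed

lemma spine_lower_bound: "height x = l \<Longrightarrow> \<bar>of_int l\<bar> \<le> spine l x"
  by (simp add: spine_def)

text \<open>On this height the spine term is constant, and the lower end, which enters negatively,
  is capped by the height.\<close>

lemma rib_up_lower_bound: "\<exists>c. \<forall>x. height x = height f \<longrightarrow> c \<le> rib_up f x"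
proof (intro exI allI impI)
  fix x
  assume "height x = height f"
  moreover have "lower_end (diff_lamps f x) (height f) \<le> height f"
    by (rule lower_end_le) simp
  ultimately show "of_int (2 * (lower_end (lamps f) (min (height f) 0) - height f)) \<le> rib_up f x"
    unfolding rib_up_eq of_int_le_iff by simp
qed

lemma rib_down_lower_bound: "\<exists>c. \<forall>x. height x = height f \<longrightarrow> c \<le> rib_down f x"
proof -
  obtain c where "\<And>x. height x = height (mirror f) \<Longrightarrow> c \<le> rib_up (mirror f) x"
    using rib_up_lower_bound by blast
  then have "c \<le> rib_down f x" if "height x = height f" for x
    using that by (simp add: rib_down_eq)
  then show ?thesis by blast
qed

lemma horo_embedding_lower_bound: "h \<in> range horo_embedding \<Longrightarrow> \<exists>c. \<forall>x. c \<le> h x"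
proof -
  assume "h \<in> range horo_embedding"
  then obtain z where "h = horo_embedding z" by blast
  then have "- real (word_dist z \<one>\<^bsub>L2\<^esub>) \<le> h x" for x
    by (simp add: horo_embedding_def)
  then show ?thesis by blast
qed

text \<open>Rules out geodesic rays that return to one height infinitely often.\<close>

lemma horo_limit_const_lower_bound:
  assumes "horo_limit g h" "\<And>n. height (g n) = l"
  shows "\<exists>c. \<forall>x. height x = l \<longrightarrow> c \<le> h x"
proof -
  consider "h = spine l" | f where "height f = l" "h = rib_up f"
    | f where "height f = l" "h = rib_down f" | "h \<in> range horo_embedding"
    using horo_limit_cases_const[OF assms] by blast
  then show ?thesis
  proof cases
    case 1
    then show ?thesis using spine_lower_bound by blast
  next
    case 2
    then show ?thesis using rib_up_lower_bound[of f] by simp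
  next
    case 3
    then show ?thesis using rib_down_lower_bound[of f] by simp
  next
    case 4
    then show ?thesis using horo_embedding_lower_bound by blast
  qed
qed

lemma boundary_iff: "h \<in> horofunction_boundary \<longleftrightarrow> (\<exists>g. horo_limit g h) \<and> h \<notin> range horo_embedding"
  by (simp add: horofunction_boundary_def mem_closure_iff_horo_limit)

section \<open>Geodesic rays\<close>

lemma geodesic_ray_dist: "geodesic_ray \<gamma> \<Longrightarrow> m \<le> n \<Longrightarrow> travel (\<gamma> m) (\<gamma> n) = int n - int m"
proof -
  assume "geodesic_ray \<gamma>" "m \<le> n"
  then have "real (word_dist (\<gamma> m) (\<gamma> n)) = real (n - m)"
    by (simp add: geodesic_ray_def)
  then have "word_dist (\<gamma> m) (\<gamma> n) = n - m" by (simp only: of_nat_eq_iff)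
  then show ?thesis using \<open>m \<le> n\<close> by (simp add: of_nat_diff flip: word_dist_eq_travel)
qed

lemma geodesic_rayI:
  assumes "\<And>m n. m \<le> n \<Longrightarrow> travel (\<gamma> m) (\<gamma> n) = int n - int m"
  shows "geodesic_ray \<gamma>"
  unfolding geodesic_ray_def
proof (intro allI)
  fix m n
  have "real (word_dist g h) = of_int (travel g h)" for g h
    by (simp flip: word_dist_eq_travel)
  then show "real (word_dist (\<gamma> m) (\<gamma> n)) = \<bar>real m - real n\<bar>"
    using assms[of m n] assms[of n m] travel_commute[of "\<gamma> m" "\<gamma> n"]
    by (cases "m \<le> n") simp_all
qed

lemma geodesic_ray_mirror: "geodesic_ray \<gamma> \<Longrightarrow> geodesic_ray (mirror \<circ> \<gamma>)"
  by (simp add: geodesic_ray_def word_dist_mirror)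

text \<open>For n \<ge> k the distances from \<open>\<gamma> n\<close> to \<open>\<gamma> k\<close>
  and to \<open>\<gamma> 0\<close> are n - k and n, so their difference is - k before the limit is
  taken.\<close>

lemma geodesic_ray_horo_limit:
  assumes "geodesic_ray \<gamma>" "horo_limit \<gamma> h"
  shows "h (\<gamma> k) = h (\<gamma> 0) - real k"
proof -
  have "horo_embedding (\<gamma> n) (\<gamma> k) - horo_embedding (\<gamma> n) (\<gamma> 0) = - real k" if "k \<le> n" for n
    using geodesic_ray_dist[OF assms(1) that] geodesic_ray_dist[OF assms(1), of 0 n]
      travel_commute[of "\<gamma> n"]
    by (simp add: horo_embedding_eq cocycle_def)
  then have "eventually (\<lambda>n. - real k = horo_embedding (\<gamma> n) (\<gamma> k) - horo_embedding (\<gamma> n) (\<gamma> 0)) sequentially"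
    by (intro eventually_sequentiallyI[of k]) simp
  then have "(\<lambda>n. horo_embedding (\<gamma> n) (\<gamma> k) - horo_embedding (\<gamma> n) (\<gamma> 0)) \<longlonglongrightarrow> - real k"
    by (rule Lim_transform_eventually[OF tendsto_const])
  moreover have "(\<lambda>n. horo_embedding (\<gamma> n) (\<gamma> k) - horo_embedding (\<gamma> n) (\<gamma> 0)) \<longlonglongrightarrow> h (\<gamma> k) - h (\<gamma> 0)"
    using assms(2) unfolding horo_limit_iff by (intro tendsto_diff) auto
  ultimately have "h (\<gamma> k) - h (\<gamma> 0) = - real k"
    using LIMSEQ_unique by blast
  then show ?thesis by simp
qed

text \<open>By the triangle inequality d(\<gamma> n, x) - n is nonincreasing and at least -
  d(\<gamma> 0, x). Subtracting the limit at the identity gives the normalisation.\<close>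

lemma geodesic_ray_horo_limit_exists:
  assumes "geodesic_ray \<gamma>"
  shows "\<exists>h. horo_limit \<gamma> h"
proof -
  let ?f = "\<lambda>x n. real_of_int (travel (\<gamma> n) x - int n)"
  have "convergent (?f x)" for x
  proof -
    have "decseq (?f x)"
    proof (rule decseq_SucI)
      fix n
      have "travel (\<gamma> (Suc n)) x \<le> travel (\<gamma> n) x + 1"
        using travel_triangle[of "\<gamma> (Suc n)" x "\<gamma> n"] travel_commute[of "\<gamma> (Suc n)" "\<gamma> n"]
          geodesic_ray_dist[OF assms, of n "Suc n"] by simp
      then show "?f x (Suc n) \<le> ?f x n" unfolding of_int_le_iff by simp
    qed
    moreover have "\<forall>n. of_int (- travel (\<gamma> 0) x) \<le> ?f x n"
    proof
      fix n
      show "of_int (- travel (\<gamma> 0) x) \<le> ?f x n"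
      unfolding of_int_le_iff
      using travel_triangle[of "\<gamma> 0" "\<gamma> n" x] travel_commute[of x "\<gamma> n"]
        geodesic_ray_dist[OF assms, of 0 n] by simp
    qed
    ultimately obtain L where "?f x \<longlonglongrightarrow> L"
      by (rule decseq_convergent)
    then show ?thesis by (rule convergentI)
  qed
  then have l: "?f x \<longlonglongrightarrow> lim (?f x)" for x
    by (simp only: convergent_LIMSEQ_iff)
  define l where "l x = lim (?f x)" for x
  have "horo_limit \<gamma> (\<lambda>x. l x - l \<one>\<^bsub>L2\<^esub>)"
    unfolding horo_limit_iff
  proof
    fix x
    have "(\<lambda>n. ?f x n - ?f \<one>\<^bsub>L2\<^esub> n) \<longlonglongrightarrow> l x - l \<one>\<^bsub>L2\<^esub>"
      using tendsto_diff[OF l[of x] l[of "\<one>\<^bsub>L2\<^esub>"]] by (simp only: l_def)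
    then show "(\<lambda>n. horo_embedding (\<gamma> n) x) \<longlonglongrightarrow> l x - l \<one>\<^bsub>L2\<^esub>"
      by (simp add: horo_embedding_eq cocycle_def)
  qed
  then show ?thesis by blast
qed

text \<open>Nonnegativity of distances bounds \<open>horo_embedding z\<close> below by - d(z,
  id).\<close>

lemma not_embedded:
  assumes "\<And>c :: real. \<exists>x. h x < c"
  shows "h \<notin> range horo_embedding"
  using horo_embedding_lower_bound[of h] assms by (meson not_less)

lemma geodesic_ray_not_embedded:
  assumes "geodesic_ray \<gamma>" "horo_limit \<gamma> h"
  shows "h \<notin> range horo_embedding"
proof (rule not_embedded)
  fix c
  obtain k where "h (\<gamma> 0) - c < real k" using reals_Archimedean2 by blast
  then have "h (\<gamma> k) < c" using geodesic_ray_horo_limit[OF assms, of k] by simp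
  then show "\<exists>x. h x < c" by blast
qed

text \<open>A rising subsequence is enough, since \<open>h\<close> is already the limit along the
  whole ray.\<close>

lemma geodesic_ray_cases_at_top:
  assumes \<gamma>: "geodesic_ray \<gamma>" "horo_limit \<gamma> h"
    and r: "strict_mono r" "filterlim (\<lambda>n. height (\<gamma> (r n))) at_top sequentially"
  shows "\<exists>L. bdd_below L \<and> h = (\<lambda>x. of_int (busemann_up L x))"
proof -
  have "h \<noteq> (\<lambda>x. of_int (height x))"
  proof
    assume h: "h = (\<lambda>x. of_int (height x))"
    have "eventually (\<lambda>n. height (\<gamma> 0) + 1 \<le> height (\<gamma> (r n))) sequentially"
      using r(2) unfolding filterlim_at_top by blast
    then obtain n where n: "height (\<gamma> 0) + 1 \<le> height (\<gamma> (r n))"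
      using eventually_happens'[OF sequentially_bot] by blast
    show False using geodesic_ray_horo_limit[OF \<gamma>, of "r n"] n unfolding h by linarith
  qed
  moreover have "filterlim (\<lambda>n. height ((\<gamma> \<circ> r) n)) at_top sequentially"
    using r(2) by simp
  ultimately show ?thesis
    using horo_limit_cases_at_top[OF horo_limit_subseq[OF \<gamma>(2) r(1)]] by blast
qed

lemma geodesic_ray_cases:
  assumes \<gamma>: "geodesic_ray \<gamma>" "horo_limit \<gamma> h"
  shows "\<exists>L. bdd_below L \<and> (h = (\<lambda>x. of_int (busemann_up L x)) \<or> h = (\<lambda>x. of_int (busemann_up L (mirror x))))"
proof (cases rule: int_subseq[of "\<lambda>n. height (\<gamma> n)"])
  case (1 r l)
  have "\<exists>c. \<forall>x. height x = l \<longrightarrow> c \<le> h x"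
    by (rule horo_limit_const_lower_bound[OF horo_limit_subseq[OF \<gamma>(2) 1(1)]]) (simp add: 1(2))
  then obtain c where c: "\<And>x. height x = l \<Longrightarrow> c \<le> h x" by blast
  \<comment> \<open>At the returns to height \<open>l\<close> the values of \<open>h\<close> fall
    without bound, against \<open>c\<close>.\<close>
  obtain k where k: "h (\<gamma> 0) - c < real k" using reals_Archimedean2 by blast
  have "c \<le> h (\<gamma> 0) - real (r k)"
    using c[OF 1(2)[of k]] geodesic_ray_horo_limit[OF \<gamma>, of "r k"] by simp
  moreover have "k \<le> r k" using 1(1) by (rule seq_suble)
  ultimately show ?thesis using k by simp
next
  case (2 r)
  from geodesic_ray_cases_at_top[OF \<gamma> this] show ?thesis by metis
next
  case (3 r)
  have "filterlim (\<lambda>n. - height (\<gamma> (r n))) at_top sequentially"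
    using 3(2) filterlim_uminus_int[of "\<lambda>n. - height (\<gamma> (r n))"] by simp
  then have "filterlim (\<lambda>n. height ((mirror \<circ> \<gamma>) (r n))) at_top sequentially" by simp
  from geodesic_ray_cases_at_top[OF geodesic_ray_mirror[OF \<gamma>(1)] horo_limit_mirror[OF \<gamma>(2)] 3(1) this]
  obtain L where L: "bdd_below L" "h \<circ> mirror = (\<lambda>x. of_int (busemann_up L x))" by blast
  have "h = (\<lambda>x. of_int (busemann_up L (mirror x)))"
  proof
    fix x
    show "h x = of_int (busemann_up L (mirror x))"
      using fun_cong[OF L(2), of "mirror x"] by simp
  qed
  then show ?thesis using L(1) by (intro exI[of _ L] conjI disjI2)
qed

lemma ray_lamps_eq:
  assumes L: "lamps_converge \<gamma> L"
  shows "ray_lamps \<gamma> = L"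
proof -
  have ev: "eventually (\<lambda>n. i \<in> lamps (\<gamma> n) \<longleftrightarrow> i \<in> L) sequentially" for i
    using L by (simp add: lamps_converge_def)
  have "i \<in> L" if "i \<in> ray_lamps \<gamma>" for i
  proof -
    have "eventually (\<lambda>n. i \<in> lamps (\<gamma> n)) sequentially" using that by (simp add: ray_lamps_def)
    with ev[of i] have "eventually (\<lambda>n. i \<in> L) sequentially" by eventually_elim simp
    then show ?thesis by simp
  qed
  moreover have "i \<in> ray_lamps \<gamma>" if "i \<in> L" for i
    using ev[of i] that by (simp add: ray_lamps_def)
  ultimately show ?thesis by blast
qed

text \<open>Along the ray the limit drops by one at each step while the height tends to infinity, so the
  lowest lamp at which \<open>\<gamma> k\<close> differs from \<open>L\<close> escapes to infinity.\<close>

lemma geodesic_ray_lamps_converge: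
  assumes \<gamma>: "geodesic_ray \<gamma>" "horo_limit \<gamma> (\<lambda>x. of_int (busemann_up L x))"
    and top: "filterlim (\<lambda>n. height (\<gamma> n)) at_top sequentially" and L: "bdd_below L"
  shows "lamps_converge \<gamma> L"
  unfolding lamps_converge_def
proof
  fix i
  let ?low = "\<lambda>k. lower_end (sym_diff L (lamps (\<gamma> k))) (height (\<gamma> k))"
  \<comment> \<open>Collects the terms independent of \<open>k\<close> when the unit descent of the
    limit is solved for the lower end.\<close>
  let ?c = "2 * lower_end L 0 - busemann_up L (\<gamma> 0)"
  have eq: "2 * ?low k = ?c + height (\<gamma> k) + int k" for k
  proof -
    have "real_of_int (busemann_up L (\<gamma> k)) = real_of_int (busemann_up L (\<gamma> 0) - int k)"
      using geodesic_ray_horo_limit[OF \<gamma>, of k] by simp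
    then have "busemann_up L (\<gamma> k) = busemann_up L (\<gamma> 0) - int k"
      by (simp only: of_int_eq_iff)
    then show ?thesis by (simp add: busemann_up_def)
  qed
  have "eventually (\<lambda>k. 2 * i + 1 - ?c \<le> height (\<gamma> k)) sequentially"
    using top unfolding filterlim_at_top by blast
  then show "eventually (\<lambda>k. i \<in> lamps (\<gamma> k) \<longleftrightarrow> i \<in> L) sequentially"
  proof eventually_elim
    case (elim k)
    then have "i < ?low k" using eq[of k] by linarith
    moreover have "?low k \<le> i" if "i \<in> sym_diff L (lamps (\<gamma> k))"
      using that L by (intro lower_end_le_mem iffD2[OF bdd_below_sym_diff])
    ultimately show ?case by fastforce
  qed
qed

text \<open>The classification only names some \<open>L\<close>; convergence of the lamps identifies
  it with \<open>ray_lamps\<close>, so the limit is the function given by the formula for this very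
  ray.\<close>

lemma rays_up_horo_limit:
  assumes "\<gamma> \<in> rays_up"
  shows "bdd_below (ray_lamps \<gamma>)" and "horo_limit \<gamma> (b_up \<gamma>)"
proof -
  have \<gamma>: "geodesic_ray \<gamma>" "filterlim (\<lambda>n. height (\<gamma> n)) at_top sequentially"
    using assms by (auto simp: rays_up_def)
  obtain h where h: "horo_limit \<gamma> h" using geodesic_ray_horo_limit_exists[OF \<gamma>(1)] by blast
  have "filterlim (\<lambda>n. height (\<gamma> (id n))) at_top sequentially" using \<gamma>(2) by simp
  from geodesic_ray_cases_at_top[OF \<gamma>(1) h strict_mono_id this] obtain L
    where L: "bdd_below L" "h = (\<lambda>x. of_int (busemann_up L x))" by blast
  have h': "horo_limit \<gamma> (\<lambda>x. of_int (busemann_up L x))" using h L(2) by simp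
  from geodesic_ray_lamps_converge[OF \<gamma>(1) h' \<gamma>(2) L(1)] have "ray_lamps \<gamma> = L"
    by (rule ray_lamps_eq)
  then show bdd: "bdd_below (ray_lamps \<gamma>)" and "horo_limit \<gamma> (b_up \<gamma>)"
    using L(1) h' by (simp_all add: b_up_eq)
qed

text \<open>The ray first descends from the identity to the lowest lamp of \<open>L\<close> (if that is below \<open>0\<close>)
  without switching any lamp and then ascends, lighting the lamps of \<open>L\<close> on its way.\<close>

lemma rays_up_exists:
  assumes L: "bdd_below L"
  shows "\<exists>\<gamma>\<in>rays_up. ray_lamps \<gamma> = L"
proof -
  define b where "b = lower_end L 0"
  have b0: "b \<le> 0" and b_le: "\<And>i. i \<in> L \<Longrightarrow> b \<le> i"
    using lower_end_le[OF L] lower_end_le_mem[OF L] by (auto simp: b_def)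
  \<comment> \<open>The lamp at a negative \<open>b\<close> has to be lit, which makes the detour
    down to \<open>b\<close> unavoidable and hence geodesic.\<close>
  have b_mem: "b \<in> L" if "b < 0"
    using lower_end_attained[OF L, of 0] that by (auto simp: b_def)
  \<comment> \<open>The turn is at time \<open>- b\<close>: the height is \<open>- n\<close> before
    and \<open>2 * b + n\<close> after it, and \<open>max 0\<close> keeps all lamps off until
    then.\<close>
  define \<gamma> where
    "\<gamma> n = lamp_stand (L \<inter> {..<b + max 0 (int n + b)}) (b + \<bar>int n + b\<bar>)" for n
  have "L \<inter> {..<m} \<subseteq> {b..<m}" for m using b_le by auto
  then have "finite (L \<inter> {..<m})" for m by (rule finite_subset) simp
  then have lamps: "i \<in> lamps (\<gamma> n) \<longleftrightarrow> i \<in> L \<and> i < b + max 0 (int n + b)" for i n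
    by (simp add: \<gamma>_def)
  have height: "height (\<gamma> n) = b + \<bar>int n + b\<bar>" for n by (simp add: \<gamma>_def)
  have "geodesic_ray \<gamma>"
  proof (rule geodesic_rayI)
    fix m n :: nat
    assume mn: "m \<le> n"
    have D: "(i \<in> lamps (\<gamma> m)) \<noteq> (i \<in> lamps (\<gamma> n)) \<longleftrightarrow>
        i \<in> L \<and> b + max 0 (int m + b) \<le> i \<and> i < b + max 0 (int n + b)" for i
      using mn by (auto simp: lamps)
    have le_low: "c \<le> low (\<gamma> m) (\<gamma> n) \<longleftrightarrow> c \<le> b + \<bar>int m + b\<bar> \<and> c \<le> b + \<bar>int n + b\<bar> \<and>
        (\<forall>i. i \<in> L \<and> b + max 0 (int m + b) \<le> i \<and> i < b + max 0 (int n + b) \<longrightarrow> c \<le> i)" for c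
      unfolding le_low_iff D height by (rule refl)
    have high_le: "high (\<gamma> m) (\<gamma> n) \<le> c \<longleftrightarrow> b + \<bar>int m + b\<bar> \<le> c \<and> b + \<bar>int n + b\<bar> \<le> c \<and>
        (\<forall>i. i \<in> L \<and> b + max 0 (int m + b) \<le> i \<and> i < b + max 0 (int n + b) \<longrightarrow> i < c)" for c
      unfolding high_le_iff D height by (rule refl)
    consider "int n + b \<le> 0" | "0 \<le> int m + b" | "int m + b < 0" "0 < int n + b" by linarith
    then show "travel (\<gamma> m) (\<gamma> n) = int n - int m"
    proof cases
      case 1
      have "low (\<gamma> m) (\<gamma> n) = - int n"
        by (rule antisym) (use 1 mn low_le(2)[of "\<gamma> m" "\<gamma> n"] in \<open>simp_all add: le_low height\<close>)
      moreover have "high (\<gamma> m) (\<gamma> n) = - int m"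
        by (rule antisym) (use 1 mn high_ge(1)[of "\<gamma> m" "\<gamma> n"] in \<open>simp_all add: high_le height\<close>)
      ultimately show ?thesis using 1 mn by (simp add: travel_def height)
    next
      case 2
      have "low (\<gamma> m) (\<gamma> n) = 2 * b + int m"
        by (rule antisym) (use 2 mn low_le(1)[of "\<gamma> m" "\<gamma> n"] in \<open>simp_all add: le_low height\<close>)
      moreover have "high (\<gamma> m) (\<gamma> n) = 2 * b + int n"
        by (rule antisym) (use 2 mn high_ge(2)[of "\<gamma> n" "\<gamma> m"] in \<open>simp_all add: high_le height\<close>)
      ultimately show ?thesis using 2 mn by (simp add: travel_def height)
    next
      case 3
      then have "b \<in> L" using b_mem by linarith
      then have "low (\<gamma> m) (\<gamma> n) = b"
        using 3 low_le(3)[of b "\<gamma> m" "\<gamma> n", unfolded D] b_le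
        by (intro antisym) (simp_all add: le_low)
      moreover have "high (\<gamma> m) (\<gamma> n) = max (- int m) (2 * b + int n)"
      proof (rule antisym)
        show "high (\<gamma> m) (\<gamma> n) \<le> max (- int m) (2 * b + int n)"
          using 3 by (auto simp: high_le)
        show "max (- int m) (2 * b + int n) \<le> high (\<gamma> m) (\<gamma> n)"
          using 3 high_ge(1)[of "\<gamma> m" "\<gamma> n"] high_ge(2)[of "\<gamma> n" "\<gamma> m"] by (simp add: height)
      qed
      \<comment> \<open>Twice the larger height minus the distance of the heights is their sum
        \<open>2 * b + n - m\<close>; subtracting twice the lower end \<open>b\<close> leaves
        \<open>n - m\<close>.\<close>
      ultimately show ?thesis using 3 by (simp add: travel_def height max_def abs_if)
    qed
  qed
  moreover have "\<gamma> 0 = \<one>\<^bsub>L2\<^esub>"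
    using b0 b_le by (auto simp: lamplighter_eq_iff lamps height set_eq_iff) force
  moreover have "filterlim (\<lambda>n. height (\<gamma> n)) at_top sequentially"
    unfolding filterlim_at_top
  proof
    fix Z
    show "eventually (\<lambda>n. Z \<le> height (\<gamma> n)) sequentially"
      by (rule eventually_sequentiallyI[of "nat (Z - 2 * b)"]) (simp add: height)
  qed
  moreover have "lamps_converge \<gamma> L"
    unfolding lamps_converge_def
  proof
    fix i
    show "eventually (\<lambda>n. i \<in> lamps (\<gamma> n) \<longleftrightarrow> i \<in> L) sequentially"
      by (rule eventually_sequentiallyI[of "nat (i + 1 - 2 * b)"]) (auto simp: lamps)
  qed
  then have "ray_lamps \<gamma> = L" by (rule ray_lamps_eq)
  ultimately show ?thesis unfolding rays_up_def by blast
qed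

lemma rays_down_iff: "\<gamma> \<in> rays_down \<longleftrightarrow> mirror \<circ> \<gamma> \<in> rays_up"
proof -
  have "mirror (\<gamma> 0) = \<one>\<^bsub>L2\<^esub> \<longleftrightarrow> \<gamma> 0 = \<one>\<^bsub>L2\<^esub>"
    by (metis mirror_mirror mirror_one)
  moreover have "filterlim (\<lambda>n. - height (\<gamma> n)) at_top sequentially \<longleftrightarrow> filterlim (\<lambda>n. height (\<gamma> n)) at_bot sequentially"
    using filterlim_uminus_int[of "\<lambda>n. - height (\<gamma> n)" sequentially] by simp
  moreover have "geodesic_ray (mirror \<circ> \<gamma>) \<longleftrightarrow> geodesic_ray \<gamma>"
    by (simp add: geodesic_ray_def word_dist_mirror)
  ultimately show ?thesis by (simp add: rays_down_def rays_up_def)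
qed

lemma ray_lamps_mirror: "ray_lamps (mirror \<circ> \<gamma>) = reflect (ray_lamps \<gamma>)"
  by (auto simp: ray_lamps_def)

lemma b_down_mirror:
  assumes "\<gamma> \<in> rays_down"
  shows "b_down \<gamma> = b_up (mirror \<circ> \<gamma>) \<circ> mirror"
proof -
  have "bdd_below (ray_lamps (mirror \<circ> \<gamma>))"
    using assms rays_up_horo_limit(1)[of "mirror \<circ> \<gamma>"] rays_down_iff[of \<gamma>] by simp
  then show ?thesis
    by (simp add: b_up_eq b_down_eq ray_lamps_mirror fun_eq_iff)
qed

lemma rays_down_horo_limit:
  assumes "\<gamma> \<in> rays_down"
  shows "bdd_above (ray_lamps \<gamma>)" and "horo_limit \<gamma> (b_down \<gamma>)"
proof -
  have up: "mirror \<circ> \<gamma> \<in> rays_up" using assms rays_down_iff by blast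
  show "bdd_above (ray_lamps \<gamma>)"
    using rays_up_horo_limit(1)[OF up] by (simp add: ray_lamps_mirror)
  have "mirror \<circ> (mirror \<circ> \<gamma>) = \<gamma>" by (simp add: fun_eq_iff)
  then show "horo_limit \<gamma> (b_down \<gamma>)"
    using horo_limit_mirror[OF rays_up_horo_limit(2)[OF up]] b_down_mirror[OF assms] by simp
qed

section \<open>The families of horofunctions\<close>

lemma mem_boundary_upD: "c \<in> boundary_up \<Longrightarrow> \<gamma> \<in> c \<Longrightarrow> \<gamma> \<in> rays_up"
  by (auto simp: boundary_up_def quotient_def)

lemma mem_boundary_downD: "c \<in> boundary_down \<Longrightarrow> \<gamma> \<in> c \<Longrightarrow> \<gamma> \<in> rays_down"
  by (auto simp: boundary_down_def quotient_def)

lemma asymptotic_refl: "asymptotic \<gamma> \<gamma>"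
  by (simp add: asymptotic_def)

lemma mem_boundary_upI: "\<gamma> \<in> rays_up \<Longrightarrow> \<exists>c\<in>boundary_up. \<gamma> \<in> c"
  unfolding boundary_up_def
  by (intro bexI[OF _ quotientI[of \<gamma>]]) (simp_all add: asymptotic_refl)

lemma mem_boundary_downI: "\<gamma> \<in> rays_down \<Longrightarrow> \<exists>c\<in>boundary_down. \<gamma> \<in> c"
  unfolding boundary_down_def
  by (intro bexI[OF _ quotientI[of \<gamma>]]) (simp_all add: asymptotic_refl)

text \<open>Classes consist of rays, and by reflexivity each ray lies in a class.\<close>

lemma busemann_family_eq: "busemann_family = b_up ` rays_up \<union> b_down ` rays_down"
proof -
  have "{b_up \<gamma> | \<gamma> c. c \<in> boundary_up \<and> \<gamma> \<in> c} = b_up ` rays_up"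
  proof (intro equalityI subsetI)
    fix h assume "h \<in> {b_up \<gamma> | \<gamma> c. c \<in> boundary_up \<and> \<gamma> \<in> c}"
    then show "h \<in> b_up ` rays_up" using mem_boundary_upD by fastforce
  next
    fix h assume "h \<in> b_up ` rays_up"
    then obtain \<gamma> where \<gamma>: "h = b_up \<gamma>" "\<gamma> \<in> rays_up" by blast
    then show "h \<in> {b_up \<gamma> | \<gamma> c. c \<in> boundary_up \<and> \<gamma> \<in> c}"
      using mem_boundary_upI[OF \<gamma>(2)] by auto
  qed
  moreover have "{b_down \<gamma> | \<gamma> c. c \<in> boundary_down \<and> \<gamma> \<in> c} = b_down ` rays_down"
  proof (intro equalityI subsetI)
    fix h assume "h \<in> {b_down \<gamma> | \<gamma> c. c \<in> boundary_down \<and> \<gamma> \<in> c}"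
    then show "h \<in> b_down ` rays_down" using mem_boundary_downD by fastforce
  next
    fix h assume "h \<in> b_down ` rays_down"
    then obtain \<gamma> where \<gamma>: "h = b_down \<gamma>" "\<gamma> \<in> rays_down" by blast
    then show "h \<in> {b_down \<gamma> | \<gamma> c. c \<in> boundary_down \<and> \<gamma> \<in> c}"
      using mem_boundary_downI[OF \<gamma>(2)] by auto
  qed
  ultimately show ?thesis by (simp add: busemann_family_def)
qed

lemma busemann_up_mem_family:
  assumes "bdd_below L"
  shows "(\<lambda>x. of_int (busemann_up L x)) \<in> b_up ` rays_up"
proof -
  obtain \<gamma> where "\<gamma> \<in> rays_up" "ray_lamps \<gamma> = L"
    using rays_up_exists[OF assms] by blast
  then show ?thesis using b_up_eq[of \<gamma>] assms by (intro image_eqI[of _ _ \<gamma>]) simp_all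
qed

lemma busemann_up_mirror_mem_family:
  assumes "bdd_below L"
  shows "(\<lambda>x. of_int (busemann_up L (mirror x))) \<in> b_down ` rays_down"
proof -
  obtain \<gamma> where \<gamma>: "\<gamma> \<in> rays_up" "ray_lamps \<gamma> = L"
    using rays_up_exists[OF assms] by blast
  have *: "mirror \<circ> (mirror \<circ> \<gamma>) = \<gamma>" by (simp add: fun_eq_iff)
  then have down: "mirror \<circ> \<gamma> \<in> rays_down" using \<gamma>(1) rays_down_iff[of "mirror \<circ> \<gamma>"] by simp
  have "b_down (mirror \<circ> \<gamma>) = (\<lambda>x. of_int (busemann_up L (mirror x)))"
    using b_down_mirror[OF down] b_up_eq[of \<gamma>] \<gamma>(2) assms by (simp add: * fun_eq_iff)
  then show ?thesis using down by (intro image_eqI[of _ _ "mirror \<circ> \<gamma>"]) simp_all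
qed

lemma busemann_family_geodesic:
  assumes "h \<in> busemann_family"
  shows "\<exists>\<gamma>. geodesic_ray \<gamma> \<and> horo_limit \<gamma> h"
proof -
  from assms consider \<gamma> where "\<gamma> \<in> rays_up" "h = b_up \<gamma>" | \<gamma> where "\<gamma> \<in> rays_down" "h = b_down \<gamma>"
    unfolding busemann_family_eq by blast
  then show ?thesis
  proof cases
    case 1
    then show ?thesis using rays_up_horo_limit(2)[OF 1(1)] by (intro exI[of _ \<gamma>]) (simp add: rays_up_def)
  next
    case 2
    then show ?thesis using rays_down_horo_limit(2)[OF 2(1)] by (intro exI[of _ \<gamma>]) (simp add: rays_down_def)
  qed
qed

text \<open>A Busemann point may come from a ray with any starting point; through its configuration
  it is also the limit of a ray from the identity.\<close>

lemma busemann_points_eq: "busemann_points = busemann_family"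
proof (intro equalityI subsetI)
  fix h
  assume "h \<in> busemann_points"
  then obtain \<gamma> where "geodesic_ray \<gamma>" "horo_limit \<gamma> h"
    unfolding busemann_points_def by blast
  from geodesic_ray_cases[OF this] obtain L where "bdd_below L"
    "h = (\<lambda>x. of_int (busemann_up L x)) \<or> h = (\<lambda>x. of_int (busemann_up L (mirror x)))" by metis
  then show "h \<in> busemann_family"
    using busemann_up_mem_family[of L] busemann_up_mirror_mem_family[of L]
    unfolding busemann_family_eq by (elim disjE) simp_all
next
  fix h
  assume "h \<in> busemann_family"
  then obtain \<gamma> where \<gamma>: "geodesic_ray \<gamma>" "horo_limit \<gamma> h"
    using busemann_family_geodesic by blast
  then show "h \<in> busemann_points"
    using geodesic_ray_not_embedded[OF \<gamma>] unfolding busemann_points_def boundary_iff by blast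
qed

section \<open>Sequences realising each family\<close>

lemma bdd_all_lamps_mirror:
  "bdd_above (all_lamps (mirror \<circ> g)) \<longleftrightarrow> bdd_below (all_lamps g)"
  "bdd_below (all_lamps (mirror \<circ> g)) \<longleftrightarrow> bdd_above (all_lamps g)"
proof -
  have "all_lamps (mirror \<circ> g) = reflect (all_lamps g)"
    by (auto simp: all_lamps_def)
  then show "bdd_above (all_lamps (mirror \<circ> g)) \<longleftrightarrow> bdd_below (all_lamps g)"
    "bdd_below (all_lamps (mirror \<circ> g)) \<longleftrightarrow> bdd_above (all_lamps g)" by simp_all
qed

lemma filterlim_height_mirror:
  "filterlim (\<lambda>n. height ((mirror \<circ> g) n)) at_bot sequentially \<longleftrightarrow> filterlim (\<lambda>n. height (g n)) at_top sequentially"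
  using filterlim_uminus_int[of "\<lambda>n. height (g n)"] by simp

text \<open>Truncations of the limit configuration replace the ray: their lamps all lie in
  \<open>L\<close>, so the common lower bound is immediate.\<close>

lemma b_up_sequence:
  assumes "\<gamma> \<in> rays_up"
  shows "\<exists>g. horo_limit g (b_up \<gamma>) \<and> bdd_below (all_lamps g)
    \<and> filterlim (\<lambda>n. height (g n)) at_top sequentially"
proof -
  define L where "L = ray_lamps \<gamma>"
  have bdd: "bdd_below L" using rays_up_horo_limit(1)[OF assms] by (simp add: L_def)
  then obtain b where b: "\<And>i. i \<in> L \<Longrightarrow> b \<le> i" unfolding bdd_below_def by blast
  define g where "g n = lamp_stand (L \<inter> {..<int n}) (int n)" for n
  have "L \<inter> {..<m} \<subseteq> {b..<m}" for m using b by auto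
  then have "finite (L \<inter> {..<m})" for m by (rule finite_subset) simp
  then have lamps: "lamps (g n) = L \<inter> {..<int n}" for n
    by (simp add: g_def)
  have height: "height (g n) = int n" for n by (simp add: g_def)
  have top: "filterlim (\<lambda>n. height (g n)) at_top sequentially"
    unfolding height by (rule filterlim_int_sequentially)
  have "horo_limit g (\<lambda>x. of_int (busemann_up L x))"
  proof (rule horo_limit_busemann_up[OF top])
    show "lamps_converge g L"
      unfolding lamps_converge_def
    proof
      fix i
      show "eventually (\<lambda>n. i \<in> lamps (g n) \<longleftrightarrow> i \<in> L) sequentially"
        by (rule eventually_sequentiallyI[of "nat (i + 1)"]) (auto simp: lamps)
    qed
    show "i \<in> lamps (g n) \<Longrightarrow> b \<le> i" for n i using b by (simp add: lamps)
  qed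
  then have "horo_limit g (b_up \<gamma>)"
    using b_up_eq[of \<gamma>] bdd by (simp add: L_def)
  moreover have "bdd_below (all_lamps g)"
    using b by (intro bdd_belowI[of _ b]) (auto simp: all_lamps_def lamps)
  ultimately show ?thesis using top by (intro exI[of _ g] conjI)
qed

lemma b_down_sequence:
  assumes "\<gamma> \<in> rays_down"
  shows "\<exists>g. horo_limit g (b_down \<gamma>) \<and> bdd_above (all_lamps g)
    \<and> filterlim (\<lambda>n. height (g n)) at_bot sequentially"
proof -
  have "mirror \<circ> \<gamma> \<in> rays_up" using assms rays_down_iff[of \<gamma>] by simp
  from b_up_sequence[OF this] obtain g where g: "horo_limit g (b_up (mirror \<circ> \<gamma>))"
    "bdd_below (all_lamps g)" "filterlim (\<lambda>n. height (g n)) at_top sequentially" by (elim exE conjE)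
  show ?thesis
    using horo_limit_mirror[OF g(1)] g(2,3) bdd_all_lamps_mirror(1)[of g] filterlim_height_mirror[of g]
      b_down_mirror[OF assms] by (intro exI[of _ "mirror \<circ> g"]) simp
qed

lemma filterlim_at_bot_neg_int:
  assumes "\<And>n. f n \<le> - int n"
  shows "filterlim f at_bot sequentially"
  unfolding filterlim_at_bot
proof
  fix Z
  show "eventually (\<lambda>n. f n \<le> Z) sequentially"
  proof (rule eventually_sequentiallyI[of "nat (- Z)"])
    fix n assume "nat (- Z) \<le> n"
    then show "f n \<le> Z" using assms[of n] by linarith
  qed
qed

lemma filterlim_at_top_int:
  assumes "\<And>n. c + int n \<le> f n"
  shows "filterlim f at_top sequentially"
  unfolding filterlim_at_top
proof
  fix Z
  show "eventually (\<lambda>n. Z \<le> f n) sequentially"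
  proof (rule eventually_sequentiallyI[of "nat (Z - c)"])
    fix n assume "nat (Z - c) \<le> n"
    then show "Z \<le> f n" using assms[of n] by linarith
  qed
qed

text \<open>The two lamps push both ends to infinity whatever the height, which serves spine and
  height functions alike.\<close>

definition spread :: "int \<Rightarrow> nat \<Rightarrow> lamplighter" where
  "spread k n = lamp_stand {- int n, int n} k"

lemma lamps_spread [simp]: "lamps (spread k n) = {- int n, int n}"
  and height_spread [simp]: "height (spread k n) = k"
  by (simp_all add: spread_def)

lemma filterlim_low_spread: "filterlim (\<lambda>n. low (spread (k n) n) \<one>\<^bsub>L2\<^esub>) at_bot sequentially"
  by (rule filterlim_at_bot_neg_int) (rule lamps_ge_low, simp)

lemma filterlim_high_spread: "filterlim (\<lambda>n. high (spread (k n) n) \<one>\<^bsub>L2\<^esub>) at_top sequentially"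
proof (rule filterlim_at_top_int[where c = 0])
  fix n
  show "0 + int n \<le> high (spread (k n) n) \<one>\<^bsub>L2\<^esub>"
    using lamps_less_high[of "int n" "spread (k n) n"] by simp
qed

lemma not_bdd_below_int:
  assumes "\<And>n. \<exists>i\<in>A. i \<le> - int n"
  shows "\<not> bdd_below A"
proof
  assume "bdd_below A"
  then obtain b where b: "\<And>i. i \<in> A \<Longrightarrow> b \<le> i" unfolding bdd_below_def by blast
  obtain i where "i \<in> A" "i \<le> - int (nat (1 - b))" using assms by blast
  then show False using b[of i] by linarith
qed

lemma not_bdd_above_int:
  assumes "\<And>n. \<exists>i\<in>A. c + int n \<le> i"
  shows "\<not> bdd_above A"
proof
  assume "bdd_above A"
  then obtain b where b: "\<And>i. i \<in> A \<Longrightarrow> i \<le> b" unfolding bdd_above_def by blast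
  obtain i where "i \<in> A" "c + int (nat (1 + b - c)) \<le> i" using assms by blast
  then show False using b[of i] by linarith
qed

lemma not_bdd_spread:
  "\<not> bdd_below (all_lamps (\<lambda>n. spread (k n) n))" "\<not> bdd_above (all_lamps (\<lambda>n. spread (k n) n))"
proof -
  have mem: "- int n \<in> all_lamps (\<lambda>n. spread (k n) n)" "int n \<in> all_lamps (\<lambda>n. spread (k n) n)" for n
    by (auto simp: all_lamps_def)
  show "\<not> bdd_below (all_lamps (\<lambda>n. spread (k n) n))"
  proof (rule not_bdd_below_int)
    fix n
    show "\<exists>i\<in>all_lamps (\<lambda>n. spread (k n) n). i \<le> - int n"
      using mem(1)[of n] by (intro bexI[of _ "- int n"]) simp_all
  qed
  show "\<not> bdd_above (all_lamps (\<lambda>n. spread (k n) n))"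
  proof (rule not_bdd_above_int[where c = 0])
    fix n
    show "\<exists>i\<in>all_lamps (\<lambda>n. spread (k n) n). 0 + int n \<le> i"
      using mem(2)[of n] by (intro bexI[of _ "int n"]) simp_all
  qed
qed

lemma spine_sequence:
  "\<exists>g. horo_limit g (spine l) \<and> \<not> bdd_below (all_lamps g) \<and> \<not> bdd_above (all_lamps g)
     \<and> convergent (\<lambda>n. height (g n))"
proof (intro exI conjI)
  show "horo_limit (\<lambda>n. spread l n) (spine l)"
    using filterlim_low_spread[of "\<lambda>_. l"] filterlim_high_spread[of "\<lambda>_. l"]
    by (intro horo_limit_spine) simp_all
  show "convergent (\<lambda>n. height (spread l n))" by (simp add: convergent_const)
qed (rule not_bdd_spread)+

lemma horo_limit_spread: "horo_limit (\<lambda>n. spread (int n) n) (\<lambda>x. of_int (height x))"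
  by (rule horo_limit_height)
    (simp_all add: filterlim_low_spread filterlim_int_sequentially)

lemma height_sequence:
  assumes "h \<in> height_family"
  shows "\<exists>g. horo_limit g h \<and> \<not> bdd_below (all_lamps g) \<and> \<not> bdd_above (all_lamps g)
     \<and> (filterlim (\<lambda>n. height (g n)) at_top sequentially \<or> filterlim (\<lambda>n. height (g n)) at_bot sequentially)"
proof -
  let ?g = "\<lambda>n. spread (int n) n"
  have top: "filterlim (\<lambda>n. height (?g n)) at_top sequentially"
    by (simp add: filterlim_int_sequentially)
  from assms consider "h = (\<lambda>x. of_int (height x))" | "h = (\<lambda>x. - of_int (height x))"
    unfolding height_family_def by blast
  then show ?thesis
  proof cases
    case 1
    then show ?thesis
      using horo_limit_spread not_bdd_spread[of int] top by (intro exI[of _ ?g]) simp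
  next
    case 2
    have "(\<lambda>x. of_int (height x)) \<circ> mirror = h" by (simp add: 2 fun_eq_iff)
    then have "horo_limit (mirror \<circ> ?g) h" using horo_limit_mirror[OF horo_limit_spread] by simp
    moreover have "filterlim (\<lambda>n. height ((mirror \<circ> ?g) n)) at_bot sequentially"
      using top filterlim_height_mirror[of ?g] by (rule iffD2[rotated])
    ultimately show ?thesis
      using not_bdd_spread[of int] bdd_all_lamps_mirror[of ?g]
      by (intro exI[of _ "mirror \<circ> ?g"]) metis
  qed
qed

lemma rib_up_sequence:
  "\<exists>g. horo_limit g (rib_up f) \<and> bdd_below (all_lamps g) \<and> \<not> bdd_above (all_lamps g)
     \<and> (\<forall>n. height (g n) = height f)"
proof -
  define l where "l = height f"
  define b where "b = lower_end (lamps f) l"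
  have b: "b \<le> l" "\<And>i. i \<in> lamps f \<Longrightarrow> b \<le> i"
    by (simp_all add: b_def lower_end_le lower_end_le_mem)
  \<comment> \<open>The extra lamp drives the upper end to infinity, while each fixed position
    eventually agrees with \<open>f\<close>.\<close>
  define g where "g n = lamp_stand (insert (l + int n) (lamps f)) l" for n
  have lamps: "lamps (g n) = insert (l + int n) (lamps f)" and height: "height (g n) = l" for n
    by (simp_all add: g_def)
  have b': "b \<le> i" if "i \<in> lamps (g n)" for n i using that b by (auto simp: lamps)
  have "horo_limit g (rib_up f)"
  proof (rule horo_limit_rib_up[where l = l])
    show "lamps_converge g (lamps f)"
      unfolding lamps_converge_def
    proof
      fix i
      show "eventually (\<lambda>n. i \<in> lamps (g n) \<longleftrightarrow> i \<in> lamps f) sequentially"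
        by (rule eventually_sequentiallyI[of "nat (i - l + 1)"]) (auto simp: lamps)
    qed
    show "i \<in> lamps (g n) \<Longrightarrow> b \<le> i" for n i by (rule b')
    show "filterlim (\<lambda>n. high (g n) \<one>\<^bsub>L2\<^esub>) at_top sequentially"
    proof (rule filterlim_at_top_int[where c = l])
      fix n
      show "l + int n \<le> high (g n) \<one>\<^bsub>L2\<^esub>"
        using lamps_less_high[of "l + int n" "g n"] by (simp add: lamps)
    qed
  qed (simp_all add: height l_def)
  moreover have "bdd_below (all_lamps g)"
    by (rule bdd_belowI[of _ b]) (auto simp: all_lamps_def intro: b')
  moreover have "\<not> bdd_above (all_lamps g)"
  proof (rule not_bdd_above_int[where c = l])
    fix n
    have "l + int n \<in> all_lamps g" by (auto simp: all_lamps_def lamps)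
    then show "\<exists>i\<in>all_lamps g. l + int n \<le> i" by blast
  qed
  moreover have "\<forall>n. height (g n) = height f" by (simp add: height l_def)
  ultimately show ?thesis by (intro exI[of _ g] conjI)
qed

text \<open>Under i to -1 - i the conditions M(f) < H(f) and m(f) \<ge> H(f) correspond, so all ribs
  are handled through \<open>rib_up\<close>.\<close>

lemma mem_rib_family_iff:
  "h \<in> rib_family \<longleftrightarrow> (\<exists>f. (\<forall>i\<in>lamps f. i < height f) \<and> (h = rib_up f \<or> h = rib_up f \<circ> mirror))"
proof -
  have *: "(\<exists>f. h = rib_down f \<and> (\<forall>i\<in>lamps f. height f \<le> i))
      \<longleftrightarrow> (\<exists>f. h = rib_up f \<circ> mirror \<and> (\<forall>i\<in>lamps f. i < height f))" (is "?L \<longleftrightarrow> ?R")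
  proof
    assume ?L
    then obtain f where f: "h = rib_down f" "\<And>i. i \<in> lamps f \<Longrightarrow> height f \<le> i" by blast
    have "i < height (mirror f)" if "i \<in> lamps (mirror f)" for i
      using f(2)[of "- 1 - i"] that by simp
    moreover have "h = rib_up (mirror f) \<circ> mirror"
      by (simp add: f(1) fun_eq_iff rib_down_eq)
    ultimately show ?R by (intro exI[of _ "mirror f"]) blast
  next
    assume ?R
    then obtain f where f: "h = rib_up f \<circ> mirror" "\<And>i. i \<in> lamps f \<Longrightarrow> i < height f" by blast
    have "height (mirror f) \<le> i" if "i \<in> lamps (mirror f)" for i
      using f(2)[of "- 1 - i"] that by simp
    moreover have "h = rib_down (mirror f)"
      by (simp add: f(1) fun_eq_iff rib_down_eq)
    ultimately show ?L by (intro exI[of _ "mirror f"]) blast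
  qed
  show ?thesis
    unfolding rib_family_def highest_less_iff lowest_ge_iff Un_iff mem_Collect_eq * by fast
qed

lemma rib_sequence:
  assumes "h \<in> rib_family"
  shows "\<exists>g. horo_limit g h \<and> (bdd_below (all_lamps g) \<longleftrightarrow> \<not> bdd_above (all_lamps g))
     \<and> convergent (\<lambda>n. height (g n))"
proof -
  obtain f where f: "h = rib_up f \<or> h = rib_up f \<circ> mirror"
    using assms unfolding mem_rib_family_iff by (elim exE conjE)
  obtain g where g: "horo_limit g (rib_up f)" "bdd_below (all_lamps g)" "\<not> bdd_above (all_lamps g)"
      "\<forall>n. height (g n) = height f"
    using rib_up_sequence[of f] by (elim exE conjE)
  from f show ?thesis
  proof
    assume "h = rib_up f"
    then show ?thesis using g by (intro exI[of _ g]) (simp add: convergent_const)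
  next
    assume "h = rib_up f \<circ> mirror"
    then have "horo_limit (mirror \<circ> g) h" using horo_limit_mirror[OF g(1)] by simp
    moreover have "convergent (\<lambda>n. height ((mirror \<circ> g) n))"
      by (simp add: g(4) convergent_const)
    ultimately show ?thesis
      using g(2,3) bdd_all_lamps_mirror[of g] by (intro exI[of _ "mirror \<circ> g"]) simp
  qed
qed

section \<open>Separation from the embedded group\<close>

lemma real_minus_nat_unbounded: "\<exists>n::nat. (c :: real) - real n < d"
  using reals_Archimedean2[of "c - d"] by (auto simp: algebra_simps)

lemma spine_not_embedded: "spine l \<notin> range horo_embedding"
proof (rule not_embedded)
  fix c
  obtain n where n: "of_int (\<bar>l\<bar> + \<bar>l\<bar>) - real n < c" using real_minus_nat_unbounded by blast
  have "\<bar>l\<bar> - \<bar>l - int n\<bar> \<le> \<bar>l\<bar> + \<bar>l\<bar> - int n" by linarith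
  then have "spine l (lamp_stand {} (int n)) \<le> of_int (\<bar>l\<bar> + \<bar>l\<bar> - int n)"
    unfolding spine_def height_lamp_stand of_int_le_iff .
  then show "\<exists>x. spine l x < c" using n by (intro exI[of _ "lamp_stand {} (int n)"]) simp
qed

lemma rib_up_not_embedded: "rib_up f \<notin> range horo_embedding"
proof (rule not_embedded)
  fix c
  let ?l = "height f"
  let ?A = "2 * (lower_end (lamps f) (min ?l 0) - ?l) + \<bar>?l\<bar>"
  obtain n where n: "of_int ?A - real n < c" using real_minus_nat_unbounded by blast
  \<comment> \<open>With the lamps of \<open>f\<close> kept no lamp differs, so raising the
    lamplighter changes only the spine term.\<close>
  have "rib_up f (lamp_stand (lamps f) (?l + int n)) = of_int (?A - int n)"
    unfolding rib_up_eq by simp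
  then show "\<exists>x. rib_up f x < c" using n by (intro exI[of _ "lamp_stand (lamps f) (?l + int n)"]) simp
qed

lemma height_not_embedded: "(\<lambda>x. of_int (height x)) \<notin> range horo_embedding"
proof (rule not_embedded)
  fix c
  obtain n where "0 - real n < c" using real_minus_nat_unbounded by blast
  then show "\<exists>x. of_int (height x) < c" by (intro exI[of _ "lamp_stand {} (- int n)"]) simp
qed

lemma mirror_mem_range_horo_embedding:
  "h \<circ> mirror \<in> range horo_embedding \<Longrightarrow> h \<in> range horo_embedding"
proof -
  assume "h \<circ> mirror \<in> range horo_embedding"
  then obtain z where z: "h \<circ> mirror = horo_embedding z" by blast
  have "h x = horo_embedding (mirror z) x" for x
    using fun_cong[OF z, of "mirror x"] word_dist_mirror[of "mirror z" x]
      word_dist_mirror[of "mirror z" "\<one>\<^bsub>L2\<^esub>"]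
    by (simp add: horo_embedding_def)
  then show ?thesis by (metis ext rangeI)
qed

lemma families_subset_boundary:
  "busemann_family \<union> spine_family \<union> rib_family \<union> height_family \<subseteq> horofunction_boundary"
proof
  fix h
  assume "h \<in> busemann_family \<union> spine_family \<union> rib_family \<union> height_family"
  then consider "h \<in> busemann_family" | "h \<in> spine_family" | "h \<in> rib_family" | "h \<in> height_family"
    by blast
  then show "h \<in> horofunction_boundary"
  proof cases
    case 1
    then show ?thesis using busemann_points_eq by (auto simp: busemann_points_def)
  next
    case 2
    then obtain l where l: "h = spine l" by (auto simp: spine_family_def)
    show ?thesis
      unfolding boundary_iff l using spine_sequence[of l] spine_not_embedded[of l] by metis
  next
    case 3
    then obtain f where "h = rib_up f \<or> h = rib_up f \<circ> mirror"
      unfolding mem_rib_family_iff by blast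
    then have "h \<notin> range horo_embedding"
      using rib_up_not_embedded[of f] mirror_mem_range_horo_embedding[of "rib_up f"] by metis
    then show ?thesis
      unfolding boundary_iff using rib_sequence[OF 3] by metis
  next
    case 4
    have "(\<lambda>x. - of_int (height x)) = (\<lambda>x. of_int (height x)) \<circ> mirror" by (simp add: fun_eq_iff)
    then have "(\<lambda>x. - of_int (height x)) \<notin> range horo_embedding"
      using height_not_embedded mirror_mem_range_horo_embedding by metis
    then have "h \<notin> range horo_embedding"
      using 4 height_not_embedded unfolding height_family_def by (elim insertE) simp_all
    then show ?thesis
      unfolding boundary_iff using height_sequence[OF 4] by metis
  qed
qed

text \<open>A subsequence whose height is constant or infinite has the same limit; falling heights
  are reflected to rising ones.\<close>

lemma boundary_subset_families:
  "horofunction_boundary \<subseteq> busemann_family \<union> spine_family \<union> rib_family \<union> height_family"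
proof
  fix h
  assume "h \<in> horofunction_boundary"
  then obtain g where g: "horo_limit g h" and emb: "h \<notin> range horo_embedding"
    unfolding boundary_iff by blast
  show "h \<in> busemann_family \<union> spine_family \<union> rib_family \<union> height_family"
  proof (cases rule: int_subseq[of "\<lambda>n. height (g n)"])
    case (1 r l)
    have "height ((g \<circ> r) n) = l" for n using 1(2) by simp
    from horo_limit_cases_const[OF horo_limit_subseq[OF g 1(1)] this] emb
    consider "h = spine l" | f where "\<forall>i\<in>lamps f. i < height f" "h = rib_up f"
      | f where "\<forall>i\<in>lamps f. height f \<le> i" "h = rib_down f" by blast
    then show ?thesis
    proof cases
      case 1
      then show ?thesis by (simp add: spine_family_def)
    next
      case 2
      then have "h \<in> rib_family" unfolding rib_family_def highest_less_iff by blast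
      then show ?thesis by simp
    next
      case 3
      then have "h \<in> rib_family" unfolding rib_family_def lowest_ge_iff by blast
      then show ?thesis by simp
    qed
  next
    case (2 r)
    have top: "filterlim (\<lambda>n. height ((g \<circ> r) n)) at_top sequentially" using 2(2) by simp
    from horo_limit_cases_at_top[OF horo_limit_subseq[OF g 2(1)] top] show ?thesis
    proof (elim disjE exE conjE)
      assume "h = (\<lambda>x. of_int (height x))"
      then show ?thesis by (simp add: height_family_def)
    next
      fix L
      assume "bdd_below L" "h = (\<lambda>x. of_int (busemann_up L x))"
      then show ?thesis using busemann_up_mem_family[of L] by (simp add: busemann_family_eq)
    qed
  next
    case (3 r)
    have "filterlim (\<lambda>n. - height (g (r n))) at_top sequentially"
      using 3(2) filterlim_uminus_int[of "\<lambda>n. - height (g (r n))"] by simp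
    then have top: "filterlim (\<lambda>n. height ((mirror \<circ> (g \<circ> r)) n)) at_top sequentially" by simp
    have h: "h = (h \<circ> mirror) \<circ> mirror" by (simp add: fun_eq_iff)
    from horo_limit_cases_at_top[OF horo_limit_mirror[OF horo_limit_subseq[OF g 3(1)]] top] show ?thesis
    proof (elim disjE exE conjE)
      assume "h \<circ> mirror = (\<lambda>x. of_int (height x))"
      then have "h = (\<lambda>x. of_int (height x)) \<circ> mirror" using h by simp
      then have "h = (\<lambda>x. - of_int (height x))" by (simp add: fun_eq_iff)
      then show ?thesis by (simp add: height_family_def)
    next
      fix L
      assume L: "bdd_below L" "h \<circ> mirror = (\<lambda>x. of_int (busemann_up L x))"
      then have "h = (\<lambda>x. of_int (busemann_up L x)) \<circ> mirror" using h by simp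
      then have "h = (\<lambda>x. of_int (busemann_up L (mirror x)))" by (simp add: fun_eq_iff)
      then show ?thesis using busemann_up_mirror_mem_family[OF L(1)] by (simp add: busemann_family_eq)
    qed
  qed
qed

text \<open>Ribs are indexed by the countable group, the spine by the integers.\<close>

lemma countable_families: "countable (spine_family \<union> rib_family \<union> height_family)"
proof -
  have "rib_family \<subseteq> range rib_up \<union> range rib_down" unfolding rib_family_def by blast
  moreover have "countable (range rib_up \<union> range rib_down)"
    using countable_lamplighter by simp
  ultimately have "countable rib_family" by (rule countable_subset)
  then show ?thesis by (simp add: spine_family_def height_family_def)
qed

theorem theoremB:
  shows "horofunction_boundary = busemann_family \<union> spine_family \<union> rib_family \<union> height_family
    \<and> busemann_points = busemann_family
    \<and> (\<forall>c\<in>boundary_up. \<forall>\<gamma>\<in>c. \<exists>g. horo_limit g (b_up \<gamma>)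
          \<and> bdd_below (all_lamps g) \<and> filterlim (\<lambda>n. height (g n)) at_top sequentially)
    \<and> (\<forall>c\<in>boundary_down. \<forall>\<gamma>\<in>c. \<exists>g. horo_limit g (b_down \<gamma>)
          \<and> bdd_above (all_lamps g) \<and> filterlim (\<lambda>n. height (g n)) at_bot sequentially)
    \<and> (\<forall>h\<in>spine_family. \<exists>g. horo_limit g h
          \<and> \<not> bdd_below (all_lamps g) \<and> \<not> bdd_above (all_lamps g) \<and> convergent (\<lambda>n. height (g n)))
    \<and> (\<forall>h\<in>rib_family. \<exists>g. horo_limit g h
          \<and> (bdd_below (all_lamps g) \<longleftrightarrow> \<not> bdd_above (all_lamps g)) \<and> convergent (\<lambda>n. height (g n)))
    \<and> (\<forall>h\<in>height_family. \<exists>g. horo_limit g h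
          \<and> \<not> bdd_below (all_lamps g) \<and> \<not> bdd_above (all_lamps g)
          \<and> (filterlim (\<lambda>n. height (g n)) at_top sequentially
             \<or> filterlim (\<lambda>n. height (g n)) at_bot sequentially))
    \<and> countable (horofunction_boundary - busemann_points)"
proof (intro conjI ballI)
  show eq: "horofunction_boundary = busemann_family \<union> spine_family \<union> rib_family \<union> height_family"
    using boundary_subset_families families_subset_boundary by (rule equalityI)
  show "busemann_points = busemann_family" by (rule busemann_points_eq)
  show "countable (horofunction_boundary - busemann_points)"
    by (rule countable_subset[OF _ countable_families]) (auto simp: eq busemann_points_eq)
next
  fix c \<gamma>
  assume "c \<in> boundary_up" "\<gamma> \<in> c"
  then show "\<exists>g. horo_limit g (b_up \<gamma>)
          \<and> bdd_below (all_lamps g) \<and> filterlim (\<lambda>n. height (g n)) at_top sequentially"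
    by (rule b_up_sequence[OF mem_boundary_upD])
next
  fix c \<gamma>
  assume "c \<in> boundary_down" "\<gamma> \<in> c"
  then show "\<exists>g. horo_limit g (b_down \<gamma>)
          \<and> bdd_above (all_lamps g) \<and> filterlim (\<lambda>n. height (g n)) at_bot sequentially"
    by (rule b_down_sequence[OF mem_boundary_downD])
next
  fix h
  assume "h \<in> spine_family"
  then obtain l where "h = spine l" by (auto simp: spine_family_def)
  then show "\<exists>g. horo_limit g h \<and> \<not> bdd_below (all_lamps g) \<and> \<not> bdd_above (all_lamps g)
      \<and> convergent (\<lambda>n. height (g n))"
    using spine_sequence by simp
next
  fix h
  assume "h \<in> rib_family"
  then show "\<exists>g. horo_limit g h \<and> (bdd_below (all_lamps g) \<longleftrightarrow> \<not> bdd_above (all_lamps g))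
      \<and> convergent (\<lambda>n. height (g n))"
    by (rule rib_sequence)
next
  fix h
  assume "h \<in> height_family"
  then show "\<exists>g. horo_limit g h \<and> \<not> bdd_below (all_lamps g) \<and> \<not> bdd_above (all_lamps g)
      \<and> (filterlim (\<lambda>n. height (g n)) at_top sequentially
         \<or> filterlim (\<lambda>n. height (g n)) at_bot sequentially)"
    by (rule height_sequence)
qed

end
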